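(* Let $\nu\in[0,1]$. Suppose that $f$ is locally Hölder smooth in $\mathcal{B}_{3D_0}(x^* )$ with exponent $\nu$ and constant $\widehat{M}_\nu\in(0,\infty)$, that is, $\|\nabla f(x)-\nabla f(y)\|_*\le \widehat{M}_\nu\|x-y\|^\nu$ for all $x,y\in\mathcal{B}_{3D_0}(x^* )$, and suppose that $\bar r\le 4D_0$. Then Algorithm AGDA (described in the context), run for $K\ge1$ iterations, exhibits the convergence rate $$\psi(y^{k^*})-\psi(x^* )\in\mathcal{O}\left(\frac{\widehat{M}_\nu D_0^{1+\nu}\left(\frac{4D_0}{\bar r}\right)^{1/K}\log^2\!\left(\frac{eD_0}{\bar r}\right)}{K^{\frac{1+3\nu}{2}}}\right),$$ where $$k^*=\operatorname*{arg\,min}_{1\le k\le K}\frac{\bar r_k^{1/2}}{\sum_{i=0}^{k-1}\bar r_i^{1/2}}.$$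
   Context: Setting. $\|\cdot\|$ is the Euclidean norm on $\mathbb{R}^d$ and $\|\cdot\|_*$ its dual norm; $\mathcal{B}_\delta(x)$ is the closed ball of radius $\delta$ about $x$. $f:\mathbb{R}^d\to\mathbb{R}$ is continuous and convex, $g:\mathbb{R}^d\to\mathbb{R}\cup\{+\infty\}$ is proper, lower semicontinuous and convex (with an easily evaluated proximal operator), and $\psi=f+g$ is to be minimized over $\mathbb{R}^d$. $\nabla f(x)$ denotes a (sub)gradient of $f$ at $x$. $x^*$ is a minimizer of $\psi$, $x^0$ is the starting point, and $D_0=\|x^0-x^*\|$. Algorithm AGDA. Inputs: $x^0$ and $\bar r>0$. Initialize $A_0=0$, $\bar r_{-1}=\bar r_0=\bar r$, let $\beta_0>0$ be a small constant (such as $10^{-3}$), and set $v^0=y^0=x^0$. For $k=0,1,\dots,K-1$: 1. $r_k=\|x^0-v^k\|$, $\bar r_k=\max\{\bar r_{k-1},r_k\}$ (the same formulas define $r_K$ and $\bar r_K$ from $v^K$). 2. $A_{k+1}=\big(\sum_{i=0}^k\bar r_i^{1/2}\big)^2$, $a_{k+1}=A_{k+1}-A_k$, $\tau_k=a_{k+1}/A_{k+1}$. 3. $x^{k+1}=\tau_kv^k+(1-\tau_k)y^k$. 4. Find $\beta_{k+1}$ with $l_k(\beta_{k+1})\ge 0$ by the line search below, where for $\beta>0$ one defines $v^{k+1}(\beta)=\arg\min_x\big\{\sum_{i=1}^{k+1}a_i(\langle\nabla f(x^i),x\rangle+g(x))+\frac{\beta}{2}\|x-x^0\|^2\big\}$,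 $y^{k+1}(\beta)=\tau_kv^{k+1}(\beta)+(1-\tau_k)y^k$, and $$l_k(\beta)=-f(y^{k+1}(\beta))+f(x^{k+1})+\langle\nabla f(x^{k+1}),y^{k+1}(\beta)-x^{k+1}\rangle+\frac{\beta}{64\tau_k^2A_{k+1}}\|y^{k+1}(\beta)-x^{k+1}\|^2+\frac{\beta\bar r_k^2-\beta_k\bar r_{k-1}^2}{16A_{k+1}}.$$ Line search. First stage: let $i_k'$ be the smallest $i\in\{1,2,\dots\}$ with $l_k(2^{i-1}\beta_k)\ge0$. If $i_k'=1$, set $\beta_{k+1}=\beta_k$. Second stage: if $i_k'>1$, perform bisection on $[a,b]=[2^{i_k'-2}\beta_k,2^{i_k'-1}\beta_k]$: while $b-a>\frac{\beta_0}{2(k+1)^2}$, let $m=(a+b)/2$ and replace $a$ by $m$ if $l_k(m)<0$ and $b$ by $m$ otherwise; at termination set $\beta_{k+1}=b$. 5. $v^{k+1}=v^{k+1}(\beta_{k+1})$ and $y^{k+1}=\tau_kv^{k+1}+(1-\tau_k)y^k$.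
   Formalization: The factor log²(eD₀/r̄) is replaced by max(1, log(eD₀/r̄))², since the printed bound vanishes at r̄ = eD₀, where the claim fails; the hidden constant may depend on an upper bound c for β₀/(M̂_ν D₀^ν), because no constant uniform in β₀ exists. *)

theory Defs
  imports "HOL-Analysis.Analysis" "HOL-Library.While_Combinator"
begin

section \<open>Composite convex minimization\<close>

text \<open>Extended-real-valued functions never take the value \<open>-\<infinity>\<close> once they are proper, so the
  arithmetic in the convexity inequality below is unproblematic (and \<open>0 * \<infinity> = 0\<close> is
  avoided by taking \<open>t\<close> in the open unit interval).\<close>

definition proper_fun :: "('a \<Rightarrow> ereal) \<Rightarrow> bool" where
  "proper_fun g \<longleftrightarrow> (\<forall>z. g z \<noteq> -\<infinity>) \<and> (\<exists>z. g z \<noteq> \<infinity>)"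

definition lsc_fun :: "('a::topological_space \<Rightarrow> ereal) \<Rightarrow> bool" where
  "lsc_fun g \<longleftrightarrow> (\<forall>z. g z \<le> Liminf (at z) g)"

definition convex_ereal_fun :: "('a::real_vector \<Rightarrow> ereal) \<Rightarrow> bool" where
  "convex_ereal_fun g \<longleftrightarrow>
     (\<forall>u w t. 0 < t \<and> t < 1 \<longrightarrow>
        g ((1 - t) *\<^sub>R u + t *\<^sub>R w) \<le> ereal (1 - t) * g u + ereal t * g w)"

text \<open>\<open>G z\<close> plays the role of \<open>\<nabla>f(z)\<close>: a fixed selection of subgradients of \<open>f\<close>.\<close>

definition subgradient_selection :: "('a::real_inner \<Rightarrow> real) \<Rightarrow> ('a \<Rightarrow> 'a) \<Rightarrow> bool" where
  "subgradient_selection f G \<longleftrightarrow> (\<forall>z w. f z + G z \<bullet> (w - z) \<le> f w)"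

definition dual_norm :: "'a::real_inner \<Rightarrow> real" where
  "dual_norm s = onorm (\<lambda>z. s \<bullet> z)"

text \<open>Since \<open>0 powr 0 = 0\<close>, the case \<open>z = w\<close>, \<open>\<nu> = 0\<close> reads \<open>0 \<le> 0\<close> here, which is
  harmless because the left-hand side vanishes for \<open>z = w\<close>.\<close>

definition holder_smooth_on :: "'a::real_inner set \<Rightarrow> real \<Rightarrow> real \<Rightarrow> ('a \<Rightarrow> 'a) \<Rightarrow> bool" where
  "holder_smooth_on S \<nu> M G \<longleftrightarrow>
     (\<forall>z\<in>S. \<forall>w\<in>S. dual_norm (G z - G w) \<le> M * norm (z - w) powr \<nu>)"

definition psi :: "('a \<Rightarrow> real) \<Rightarrow> ('a \<Rightarrow> ereal) \<Rightarrow> 'a \<Rightarrow> ereal" where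
  "psi f g z = ereal (f z) + g z"


section \<open>Algorithm AGDA\<close>

text \<open>The index of \<open>\<bar>r\<close> starts at \<open>-1\<close>: \<open>agda_rbar_prev r x0 v k\<close> is \<open>\<bar>r\<close> at index
  \<open>k - 1\<close>, where \<open>r\<close> is the input \<open>\<bar>r\<close> of the algorithm and \<open>v\<close> the sequence of the
  points \<open>v\<^sup>k\<close>.  As \<open>v\<^sup>0 = x\<^sup>0\<close>, the value at index \<open>0\<close> is \<open>r\<close> too when \<open>r > 0\<close>.\<close>

primrec agda_rbar_prev :: "real \<Rightarrow> 'a::real_normed_vector \<Rightarrow> (nat \<Rightarrow> 'a) \<Rightarrow> nat \<Rightarrow> real" where
  "agda_rbar_prev r x0 v 0 = r"
| "agda_rbar_prev r x0 v (Suc k) = max (agda_rbar_prev r x0 v k) (norm (x0 - v k))"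

definition agda_rbar :: "real \<Rightarrow> 'a::real_normed_vector \<Rightarrow> (nat \<Rightarrow> 'a) \<Rightarrow> nat \<Rightarrow> real" where
  "agda_rbar r x0 v k = agda_rbar_prev r x0 v (Suc k)"

definition agda_A :: "real \<Rightarrow> 'a::real_normed_vector \<Rightarrow> (nat \<Rightarrow> 'a) \<Rightarrow> nat \<Rightarrow> real" where
  "agda_A r x0 v k = (\<Sum>i<k. sqrt (agda_rbar r x0 v i))\<^sup>2"

text \<open>Only used for indices \<open>k \<ge> 1\<close>.\<close>

definition agda_a :: "real \<Rightarrow> 'a::real_normed_vector \<Rightarrow> (nat \<Rightarrow> 'a) \<Rightarrow> nat \<Rightarrow> real" where
  "agda_a r x0 v k = agda_A r x0 v k - agda_A r x0 v (k - 1)"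

definition agda_tau :: "real \<Rightarrow> 'a::real_normed_vector \<Rightarrow> (nat \<Rightarrow> 'a) \<Rightarrow> nat \<Rightarrow> real" where
  "agda_tau r x0 v k = agda_a r x0 v (k + 1) / agda_A r x0 v (k + 1)"

text \<open>The candidates \<open>v\<^sup>k\<^sup>+\<^sup>1(b)\<close> and \<open>y\<^sup>k\<^sup>+\<^sup>1(b)\<close> for a trial value \<open>b\<close> of
  \<open>\<beta>\<close> at index \<open>k + 1\<close>.\<close>

definition agda_v ::
  "('a::real_inner \<Rightarrow> ereal) \<Rightarrow> ('a \<Rightarrow> 'a) \<Rightarrow> 'a \<Rightarrow> real \<Rightarrow>
   (nat \<Rightarrow> 'a) \<Rightarrow> (nat \<Rightarrow> 'a) \<Rightarrow> nat \<Rightarrow> real \<Rightarrow> 'a" where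
  "agda_v g G x0 r x v k b =
     (ARG_MIN (\<lambda>z. (\<Sum>i=1..k+1. ereal (agda_a r x0 v i) * (ereal (G (x i) \<bullet> z) + g z))
                   + ereal (b / 2 * (norm (z - x0))\<^sup>2)) z. True)"

definition agda_y ::
  "('a::real_inner \<Rightarrow> ereal) \<Rightarrow> ('a \<Rightarrow> 'a) \<Rightarrow> 'a \<Rightarrow> real \<Rightarrow>
   (nat \<Rightarrow> 'a) \<Rightarrow> (nat \<Rightarrow> 'a) \<Rightarrow> (nat \<Rightarrow> 'a) \<Rightarrow> nat \<Rightarrow> real \<Rightarrow> 'a" where
  "agda_y g G x0 r x v y k b =
     agda_tau r x0 v k *\<^sub>R agda_v g G x0 r x v k b + (1 - agda_tau r x0 v k) *\<^sub>R y k"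

definition agda_l ::
  "('a::real_inner \<Rightarrow> real) \<Rightarrow> ('a \<Rightarrow> ereal) \<Rightarrow> ('a \<Rightarrow> 'a) \<Rightarrow> 'a \<Rightarrow> real \<Rightarrow>
   (nat \<Rightarrow> 'a) \<Rightarrow> (nat \<Rightarrow> 'a) \<Rightarrow> (nat \<Rightarrow> 'a) \<Rightarrow> (nat \<Rightarrow> real) \<Rightarrow> nat \<Rightarrow> real \<Rightarrow> real" where
  "agda_l f g G x0 r x v y \<beta> k b =
     (let Y = agda_y g G x0 r x v y k b; X = x (k + 1);
          A = agda_A r x0 v (k + 1); \<tau> = agda_tau r x0 v k
      in - f Y + f X + G X \<bullet> (Y - X)
         + b / (64 * \<tau>\<^sup>2 * A) * (norm (Y - X))\<^sup>2
         + (b * (agda_rbar r x0 v k)\<^sup>2 - \<beta> k * (agda_rbar_prev r x0 v k)\<^sup>2) / (16 * A))"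

definition bisection :: "(real \<Rightarrow> real) \<Rightarrow> real \<Rightarrow> real \<Rightarrow> real \<Rightarrow> real" where
  "bisection l tol a b =
     snd (while (\<lambda>(a, b). b - a > tol)
            (\<lambda>(a, b). let m = (a + b) / 2 in if l m < 0 then (m, b) else (a, m))
            (a, b))"

definition line_search :: "(real \<Rightarrow> real) \<Rightarrow> real \<Rightarrow> real \<Rightarrow> real" where
  "line_search l tol b =
     (let i = (LEAST i. 1 \<le> i \<and> 0 \<le> l (2 ^ (i - 1) * b))
      in if i = 1 then b else bisection l tol (2 ^ (i - 2) * b) (2 ^ (i - 1) * b))"

text \<open>The sequences \<open>x, v, y, \<beta>\<close> are those produced in the first \<open>K\<close> iterations.\<close>

definition agda_run ::
  "('a::real_inner \<Rightarrow> real) \<Rightarrow> ('a \<Rightarrow> ereal) \<Rightarrow> ('a \<Rightarrow> 'a) \<Rightarrow> 'a \<Rightarrow> real \<Rightarrow> real \<Rightarrow> nat \<Rightarrow>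
   (nat \<Rightarrow> 'a) \<Rightarrow> (nat \<Rightarrow> 'a) \<Rightarrow> (nat \<Rightarrow> 'a) \<Rightarrow> (nat \<Rightarrow> real) \<Rightarrow> bool" where
  "agda_run f g G x0 r \<beta>0 K x v y \<beta> \<longleftrightarrow>
     v 0 = x0 \<and> y 0 = x0 \<and> \<beta> 0 = \<beta>0 \<and>
     (\<forall>k<K.
        x (k + 1) = agda_tau r x0 v k *\<^sub>R v k + (1 - agda_tau r x0 v k) *\<^sub>R y k \<and>
        \<beta> (k + 1) = line_search (agda_l f g G x0 r x v y \<beta> k) (\<beta>0 / (2 * (real k + 1)\<^sup>2)) (\<beta> k) \<and>
        v (k + 1) = agda_v g G x0 r x v k (\<beta> (k + 1)) \<and>
        y (k + 1) = agda_y g G x0 r x v y k (\<beta> (k + 1)))"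

text \<open>The recursion determines a run for all inputs, so \<open>agda_run\<close> is never vacuous.\<close>

lemma agda_rbar_prev_cong:
  "(\<And>i. i < k \<Longrightarrow> v i = w i) \<Longrightarrow> agda_rbar_prev r x0 v k = agda_rbar_prev r x0 w k"
  by (induction k) auto

lemma agda_rbar_cong:
  "(\<And>i. i \<le> k \<Longrightarrow> v i = w i) \<Longrightarrow> agda_rbar r x0 v k = agda_rbar r x0 w k"
  unfolding agda_rbar_def by (rule agda_rbar_prev_cong) simp

lemma agda_A_cong:
  "(\<And>i. i < k \<Longrightarrow> v i = w i) \<Longrightarrow> agda_A r x0 v k = agda_A r x0 w k"
  unfolding agda_A_def by (intro arg_cong[where f = "\<lambda>t. t\<^sup>2"] sum.cong refl arg_cong[where f = sqrt] agda_rbar_cong) auto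

lemma agda_a_cong:
  "(\<And>i. i < k \<Longrightarrow> v i = w i) \<Longrightarrow> agda_a r x0 v k = agda_a r x0 w k"
  unfolding agda_a_def by (intro arg_cong2[where f = minus] agda_A_cong) auto

lemma agda_tau_cong:
  "(\<And>i. i \<le> k \<Longrightarrow> v i = w i) \<Longrightarrow> agda_tau r x0 v k = agda_tau r x0 w k"
  unfolding agda_tau_def by (intro arg_cong2[where f = divide] agda_a_cong agda_A_cong) auto

lemma agda_v_cong:
  assumes "\<And>i. i \<le> k \<Longrightarrow> v i = w i" and "\<And>i. i \<le> k + 1 \<Longrightarrow> x i = x' i"
  shows "agda_v g G x0 r x v k = agda_v g G x0 r x' w k"
proof -
  have "agda_a r x0 v i = agda_a r x0 w i" "x i = x' i" if "i \<in> {1..k+1}" for i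
    using that by (auto intro!: agda_a_cong assms)
  then have "(\<Sum>i=1..k+1. ereal (agda_a r x0 v i) * (ereal (G (x i) \<bullet> z) + g z)) =
             (\<Sum>i=1..k+1. ereal (agda_a r x0 w i) * (ereal (G (x' i) \<bullet> z) + g z))" for z
    by (intro sum.cong) simp_all
  then show ?thesis
    unfolding agda_v_def fun_eq_iff by presburger
qed

lemma agda_y_cong:
  assumes "\<And>i. i \<le> k \<Longrightarrow> v i = w i" and "\<And>i. i \<le> k + 1 \<Longrightarrow> x i = x' i"
    and "y k = y' k"
  shows "agda_y g G x0 r x v y k = agda_y g G x0 r x' w y' k"
  using agda_v_cong[of k v w x x' g G x0 r] agda_tau_cong[of k v w r x0] assms
  by (simp add: agda_y_def fun_eq_iff)

lemma agda_l_cong: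
  assumes "\<And>i. i \<le> k \<Longrightarrow> v i = w i" and "\<And>i. i \<le> k + 1 \<Longrightarrow> x i = x' i"
    and "y k = y' k" and "\<beta> k = \<beta>' k"
  shows "agda_l f g G x0 r x v y \<beta> k = agda_l f g G x0 r x' w y' \<beta>' k"
  using agda_y_cong[of k v w x x' y y' g G x0 r] agda_tau_cong[of k v w r x0]
    agda_A_cong[of "k + 1" v w r x0] agda_rbar_cong[of k v w r x0]
    agda_rbar_prev_cong[of k v w r x0] assms
  by (simp add: agda_l_def fun_eq_iff)

lemma agda_run_exists: "\<exists>x v y \<beta>. agda_run f g G x0 r \<beta>0 K x v y \<beta>"
proof (induction K)
  case 0
  show ?case
    by (auto simp: agda_run_def intro: exI[of _ "\<lambda>_. x0"] exI[of _ "\<lambda>_. \<beta>0"])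
next
  case (Suc K)
  then obtain x v y \<beta> where run: "agda_run f g G x0 r \<beta>0 K x v y \<beta>"
    by blast
  define x' where
    "x' = x(K + 1 := agda_tau r x0 v K *\<^sub>R v K + (1 - agda_tau r x0 v K) *\<^sub>R y K)"
  define \<beta>' where
    "\<beta>' = \<beta>(K + 1 := line_search (agda_l f g G x0 r x' v y \<beta> K) (\<beta>0 / (2 * (real K + 1)\<^sup>2)) (\<beta> K))"
  define v' where "v' = v(K + 1 := agda_v g G x0 r x' v K (\<beta>' (K + 1)))"
  define y' where "y' = y(K + 1 := agda_y g G x0 r x' v y K (\<beta>' (K + 1)))"
  have same: "x' i = x i" "v' i = v i" "y' i = y i" "\<beta>' i = \<beta> i" if "i \<le> K" for i
    using that by (auto simp: x'_def v'_def y'_def \<beta>'_def)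
  have old: "agda_tau r x0 v' k = agda_tau r x0 v k"
      "agda_v g G x0 r x' v' k = agda_v g G x0 r x v k"
      "agda_y g G x0 r x' v' y' k = agda_y g G x0 r x v y k"
      "agda_l f g G x0 r x' v' y' \<beta>' k = agda_l f g G x0 r x v y \<beta> k" if "k < K" for k
    using that
    by (auto intro!: agda_tau_cong agda_v_cong agda_y_cong agda_l_cong simp: same)
  have new: "agda_tau r x0 v' K = agda_tau r x0 v K"
      "agda_v g G x0 r x' v' K = agda_v g G x0 r x' v K"
      "agda_y g G x0 r x' v' y' K = agda_y g G x0 r x' v y K"
      "agda_l f g G x0 r x' v' y' \<beta>' K = agda_l f g G x0 r x' v y \<beta> K"
    by (auto intro!: agda_tau_cong agda_v_cong agda_y_cong agda_l_cong simp: same)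
  have "agda_run f g G x0 r \<beta>0 (Suc K) x' v' y' \<beta>'"
    unfolding agda_run_def
  proof (intro conjI allI impI)
    show "v' 0 = x0" "y' 0 = x0" "\<beta>' 0 = \<beta>0"
      using run same[of 0] by (auto simp: agda_run_def)
  next
    fix k assume "k < Suc K"
    then consider "k < K" | "k = K" by linarith
    note step = this
    show "x' (k + 1) = agda_tau r x0 v' k *\<^sub>R v' k + (1 - agda_tau r x0 v' k) *\<^sub>R y' k"
      using step by cases (use run in \<open>auto simp: agda_run_def same old new\<close>, simp add: x'_def)
    show "\<beta>' (k + 1) = line_search (agda_l f g G x0 r x' v' y' \<beta>' k)
            (\<beta>0 / (2 * (real k + 1)\<^sup>2)) (\<beta>' k)"
      using step by cases (use run in \<open>auto simp: agda_run_def same old new\<close>, simp add: \<beta>'_def)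
    show "v' (k + 1) = agda_v g G x0 r x' v' k (\<beta>' (k + 1))"
      using step by cases (use run in \<open>auto simp: agda_run_def same old new\<close>, simp add: v'_def)
    show "y' (k + 1) = agda_y g G x0 r x' v' y' k (\<beta>' (k + 1))"
      using step by cases (use run in \<open>auto simp: agda_run_def same old new\<close>, simp add: y'_def)
  qed
  then show ?case by blast
qed

end

theory Submission
  imports Defs
begin

text \<open>AGDA is an estimate-sequence method. With the weights \<open>a\<^sub>i\<close>, let \<open>Q k\<close> be the sum of the
linearizations of \<open>f\<close> at \<open>x\<^sup>1, ..., x\<^sup>k\<close>, each with \<open>g\<close> added; by convexity it is a lower model of
\<open>A\<^sub>k \<psi>\<close>, and \<open>v\<^sup>k\<close> minimizes it after adding \<open>\<beta>\<^sub>k/2 \<parallel>z - x\<^sup>0\<parallel>\<^sup>2\<close>. The inequality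
\<open>l\<^sub>k(\<beta>\<^sub>k\<^sub>+\<^sub>1) \<ge> 0\<close> enforced by the line search is what makes
\<open>A\<^sub>k \<psi>(y\<^sup>k) + \<beta>\<^sub>k/2 \<parallel>z - v\<^sup>k\<parallel>\<^sup>2 \<le> Q k z + \<beta>\<^sub>k/2 \<parallel>z - x\<^sup>0\<parallel>\<^sup>2 + 3/32 \<beta>\<^sub>k R\<^sub>k\<^sub>-\<^sub>1\<^sup>2\<close>
pass from \<open>k\<close> to \<open>k + 1\<close> (\<open>estimate_Suc\<close>), where \<open>R\<^sub>k\<close> is the running maximum of
\<open>r\<close> and the distances of the \<open>v\<^sup>i\<close> from \<open>x\<^sup>0\<close>. At \<open>z = x\<^sup>*\<close> this has two
consequences. Since the gap is nonnegative, \<open>R\<^sub>k \<le> 4 D\<^sub>0\<close> keeps reproducing itself, so all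
iterates stay within \<open>2 D\<^sub>0\<close> of \<open>x\<^sup>*\<close> (\<open>v_bounded\<close>). And since \<open>\<parallel>v\<^sup>k - x\<^sup>*\<parallel>\<close> cannot fall
below \<open>D\<^sub>0 - R\<^sub>k\<close>, the gap at \<open>y\<^sup>k\<close> is at most \<open>2 \<beta>\<^sub>k D\<^sub>0 R\<^sub>k / A\<^sub>k\<close> (\<open>gap_le\<close>).

It remains to bound two factors. The first is \<open>\<beta>\<^sub>K\<close>. Whenever \<open>\<beta>\<close> grows, bisection leaves a rejected
trial value \<open>t\<close> within the tolerance of \<open>\<beta>\<^sub>k\<^sub>+\<^sub>1\<close>. Its trial point lies in the ball where \<open>f\<close> is
Hoelder smooth (\<open>trial_point_in_ball\<close>), and rejection bounds a weighted geometric mean of \<open>t\<close> and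
\<open>t - \<beta>\<^sub>k\<close> (\<open>rejected_trial_bound\<close>). Summing these increments in the right power gives
\<open>\<beta>\<^sub>K = O(M D\<^sub>0\<^sup>\<nu> K\<^sup>3\<^sup>(\<^sup>1\<^sup>-\<^sup>\<nu>\<^sup>)\<^sup>/\<^sup>2)\<close> with a constant that is uniform in \<open>\<nu>\<close> (\<open>stepsize_growth\<close>).
The second is \<open>R\<^sub>k / A\<^sub>k\<close>, the square of the ratio of \<open>\<surd>R\<^sub>k\<close> to the sum of the earlier roots. As
the roots increase from \<open>\<surd>r\<close> to at most \<open>\<surd>(4 D\<^sub>0)\<close>, the least such ratio up to \<open>K\<close> is
\<open>O((4 D\<^sub>0/r)\<^sup>1\<^sup>/\<^sup>(\<^sup>2\<^sup>K\<^sup>) log(e D\<^sub>0/r) / K)\<close>, because ratios that are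
all larger would force the partial sums to grow geometrically (\<open>min_ratio_partial_sums\<close>).
The product of the two factors has the claimed order \<open>K\<^sup>-\<^sup>(\<^sup>1\<^sup>+\<^sup>3\<^sup>\<nu>\<^sup>)\<^sup>/\<^sup>2\<close>.\<close>

section \<open>Ratios of terms to partial sums\<close>

lemma ln_one_plus_ge:
  fixes m :: real
  assumes "0 < m"
  shows "m / (1 + m) \<le> ln (1 + m)"
proof -
  have "ln (1 / (1 + m)) \<le> 1 / (1 + m) - 1"
    using assms by (intro ln_le_minus_one) simp
  moreover have "1 / (1 + m) - 1 = - (m / (1 + m))"
    using assms by (simp add: field_simps)
  ultimately show ?thesis
    using assms by (simp add: ln_div)
qed

text \<open>The ratio condition makes the partial sums grow by the factor \<open>1 + m\<close> in each step. Geometric growth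
from \<open>s 0\<close> alone would lose a factor \<open>ln K\<close>: for small \<open>k\<close> the linear growth forced by monotonicity
is the stronger one, and the two are joined at \<open>k \<approx> 1/m\<close>. For \<open>m > 1\<close> the geometric growth
starts at once; only then can \<open>m\<close> exceed a multiple of \<open>(1 + ln Q) / K\<close>, and the root
\<open>Q powr (1 / K)\<close>, with \<open>Q = s K / s 0\<close>, accounts for it.\<close>

lemma min_ratio_partial_sums:
  fixes s :: "nat \<Rightarrow> real" and m :: real
  assumes s0: "0 < s 0" and mono: "\<And>i j. i \<le> j \<Longrightarrow> s i \<le> s j"
    and K: "1 \<le> K" and m: "0 < m"
    and ratio: "\<And>k. 1 \<le> k \<Longrightarrow> k \<le> K \<Longrightarrow> m * (\<Sum>i<k. s i) \<le> s k"
  shows "m * real K \<le> 2 * (1 + ln (s K / s 0)) * (s K / s 0) powr (1 / real K)"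
proof -
  define S where "S k = (\<Sum>i<k. s i)" for k
  define Q where "Q = s K / s 0"
  have Q1: "1 \<le> Q"
    using s0 mono[of 0 K] by (simp add: Q_def)
  have lnQ: "0 \<le> ln Q"
    using Q1 by simp
  have root1: "1 \<le> Q powr (1 / real K)"
    using Q1 by (simp add: ge_one_powr_ge_zero)
  have S_ge: "real k * s 0 \<le> S k" for k
    using sum_mono[of "{..<k}" "\<lambda>_. s 0" s] mono by (simp add: S_def)
  have geo: "(1 + m) ^ n * S j \<le> S (j + n)" if "1 \<le> j" "j + n \<le> K" for j n
    using that
  proof (induction n)
    case (Suc n)
    have "(1 + m) ^ Suc n * S j \<le> (1 + m) * S (j + n)"
      using Suc m by (simp add: mult.assoc mult_left_mono)
    also have "\<dots> \<le> S (j + n) + s (j + n)"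
      using ratio[of "j + n"] Suc.prems by (simp add: S_def algebra_simps)
    finally show ?case by (simp add: S_def)
  qed simp
  have lower: "m * (1 + m) ^ (K - j) * real j \<le> Q" if "1 \<le> j" "j \<le> K" for j
  proof -
    have "m * (1 + m) ^ (K - j) * (real j * s 0) \<le> m * (1 + m) ^ (K - j) * S j"
      using S_ge m by (intro mult_left_mono) auto
    also have "\<dots> \<le> m * S K"
      using geo[of j "K - j"] that m by (simp add: mult.assoc)
    also have "\<dots> \<le> s K"
      using ratio[of K] K by (simp add: S_def)
    finally show ?thesis
      using s0 by (simp add: Q_def field_simps)
  qed
  show ?thesis
  proof (cases "m \<le> 1")
    case True
    \<comment> \<open>The trivial bound \<open>S j \<ge> j * s 0\<close> is used up to \<open>j = p\<close>, the geometric growth from there on.\<close>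
    define p where "p = nat \<lceil>1 / m\<rceil>"
    have "0 < \<lceil>1 / m\<rceil>"
      using m by simp
    then have p: "1 / m \<le> real p" "real p < 1 / m + 1" "1 \<le> p"
      unfolding p_def by linarith+
    have mp: "1 \<le> m * real p" "m * real p \<le> 1 + m"
      using p m by (auto simp: field_simps)
    have "m * real K \<le> 2 + 2 * ln Q"
    proof (cases "p \<le> K")
      case pK: True
      have "(1 + m) ^ (K - p) * 1 \<le> (1 + m) ^ (K - p) * (m * real p)"
        using mp m by (intro mult_left_mono) auto
      also have "\<dots> \<le> Q"
        using lower[OF p(3) pK] by (simp add: mult_ac)
      finally have "ln ((1 + m) ^ (K - p)) \<le> ln Q"
        using m by (intro ln_mono) auto
      then have 1: "real (K - p) * ln (1 + m) \<le> ln Q"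
        using m by (simp add: ln_realpow)
      have "m / 2 \<le> m / (1 + m)"
        using m True by (intro divide_left_mono) auto
      then have "m / 2 \<le> ln (1 + m)"
        using ln_one_plus_ge[OF m] by linarith
      then have "real (K - p) * (m / 2) \<le> ln Q"
        using 1 by (meson mult_left_mono of_nat_0_le_iff order_trans)
      then have "(real K - real p) * m \<le> 2 * ln Q"
        using pK by (simp add: of_nat_diff)
      then show ?thesis
        using mp True by (simp add: algebra_simps)
    next
      case False
      then have "real K < 1 / m + 1" "real K \<le> real p - 1"
        using p by auto
      then have "real K \<le> 1 / m"
        using p by linarith
      then have "m * real K \<le> 1"
        using m by (simp add: field_simps)
      then show ?thesis using lnQ by simp
    qed
    also have "\<dots> \<le> 2 * (1 + ln Q) * Q powr (1 / real K)"
      using mult_left_mono[OF root1, of "2 * (1 + ln Q)"] lnQ by simp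
    finally show ?thesis by (simp add: Q_def)
  next
    case False
    have "m ^ K \<le> m * (1 + m) ^ (K - 1)"
      using m K power_mono[of m "1 + m" "K - 1"] by (cases K) auto
    also have "\<dots> \<le> Q"
      using lower[of 1] K by simp
    finally have mQ: "m ^ K \<le> Q" .
    have "m = (m ^ K) powr (1 / real K)"
      using m K by (simp add: powr_realpow[symmetric] powr_powr)
    also have "\<dots> \<le> Q powr (1 / real K)"
      using mQ m by (intro powr_mono2) auto
    finally have 1: "m \<le> Q powr (1 / real K)" .
    have "2 ^ (K - 1) \<le> (1 + m) ^ (K - 1)"
      using False by (intro power_mono) auto
    also have "\<dots> \<le> m * (1 + m) ^ (K - 1)"
      using False by (simp add: mult_left_le)
    also have "\<dots> \<le> Q"
      using lower[of 1] K by simp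
    finally have "ln (2 ^ (K - 1)) \<le> ln Q"
      by (intro ln_mono) auto
    then have "real (K - 1) * ln 2 \<le> ln Q"
      by (simp add: ln_realpow)
    moreover have "1 / 2 \<le> ln (2::real)"
      using ln_one_plus_ge[of 1] by simp
    then have "real (K - 1) * (1 / 2) \<le> real (K - 1) * ln 2"
      by (intro mult_left_mono) auto
    ultimately have "real (K - 1) * (1 / 2) \<le> ln Q"
      by linarith
    then have "real K \<le> 2 * (1 + ln Q)"
      using K by (simp add: of_nat_diff)
    then have "m * real K \<le> Q powr (1 / real K) * (2 * (1 + ln Q))"
      using 1 m by (intro mult_mono) auto
    then show ?thesis
      by (simp add: Q_def mult_ac)
  qed
qed

section \<open>Growth of the regularization parameter\<close>

text \<open>Convexity of the power function: the tangent at the larger point lies below the graph at the smaller one.\<close>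

lemma powr_diff_le:
  fixes u w q :: real
  assumes "0 \<le> w" "w \<le> u" "1 \<le> q"
  shows "u powr q - w powr q \<le> q * u powr (q - 1) * (u - w)"
proof -
  consider "w = u" | "w = 0" "w < u" | "0 < w" "w < u"
    using assms by linarith
  then show ?thesis
  proof cases
    case 2
    have "u powr q = u powr (q - 1) * u"
      using 2 by (metis diff_add_cancel less_eq_real_def powr_add powr_one)
    moreover have "u powr (q - 1) * u \<le> q * (u powr (q - 1) * u)"
      using mult_right_mono[OF assms(3), of "u powr (q - 1) * u"] 2 by simp
    ultimately show ?thesis
      using 2 by simp
  next
    case 3
    have "((\<lambda>t. t powr q) has_real_derivative q * t powr (q - 1)) (at t)" if "w \<le> t" for t
      using 3 that by (intro has_real_derivative_powr) auto
    then obtain z where z: "w < z" "z < u" "u powr q - w powr q = (u - w) * (q * z powr (q - 1))"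
      using MVT2[of w u "\<lambda>t. t powr q" "\<lambda>t. q * t powr (q - 1)"] 3 by blast
    have "z powr (q - 1) \<le> u powr (q - 1)"
      using z 3 assms by (intro powr_mono2) auto
    then have "(u - w) * (q * z powr (q - 1)) \<le> (u - w) * (q * u powr (q - 1))"
      using 3 assms by (intro mult_left_mono) auto
    then show ?thesis using z by (simp add: mult_ac)
  qed simp
qed

lemma sum_half_inverse_squares_le: "(\<Sum>j<k. 1 / (2 * (real j + 1)\<^sup>2)) \<le> 1"
proof -
  have "(\<Sum>j<Suc k. 1 / (2 * (real j + 1)\<^sup>2)) \<le> 1 - 1 / (2 * (real k + 1))" for k
  proof (induction k)
    case (Suc k)
    have "1 / (2 * (real k + 2)\<^sup>2) \<le> 1 / (2 * ((real k + 1) * (real k + 2)))"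
      unfolding power2_eq_square by (intro divide_left_mono mult_left_mono mult_right_mono) auto
    also have "\<dots> = 1 / (2 * (real k + 1)) - 1 / (2 * (real k + 2))"
      by (simp add: divide_simps) (simp add: algebra_simps)
    finally have "1 / (2 * (real k + 2)\<^sup>2) \<le> 1 / (2 * (real k + 1)) - 1 / (2 * (real k + 2))" .
    then show ?case
      using Suc by (simp add: algebra_simps)
  qed simp
  from this[of k] show ?thesis
    by (simp add: algebra_simps) (smt (verit) divide_nonneg_nonneg of_nat_0_le_iff zero_le_power2)
qed

text \<open>For \<open>\<theta> > 0\<close> the step condition, raised to the power \<open>q = 1/\<theta>\<close>, bounds
\<open>a powr (q - 1) * (a - \<beta> k)\<close> by \<open>W powr q * (k + 1)\<^sup>2\<close>. Up to the factor \<open>q\<close> the left-hand side bounds the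
increment of \<open>\<beta> powr q\<close>, so this power grows at most like \<open>K ^ 3\<close>. The factor \<open>q\<close> is
absorbed into the base by \<open>q \<le> 3 powr q\<close>, which keeps the final constant independent of \<open>\<theta>\<close> even as
\<open>\<theta>\<close> tends to \<open>0\<close>. For \<open>\<theta> = 0\<close> the step condition bounds \<open>a\<close> outright.\<close>

lemma stepsize_growth:
  fixes \<beta> :: "nat \<Rightarrow> real" and \<beta>0 W \<theta> :: real
  assumes \<theta>: "0 \<le> \<theta>" "\<theta> \<le> 1 / 2" and W: "0 < W" and K: "1 \<le> K"
    and \<beta>0: "0 < \<beta>0" "\<beta> 0 = \<beta>0" and ge: "\<And>k. k \<le> K \<Longrightarrow> \<beta>0 \<le> \<beta> k"
    and step: "\<And>k. k < K \<Longrightarrow> \<beta> (Suc k) = \<beta> k \<or>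
      (\<exists>a\<ge>\<beta> k. \<beta> (Suc k) \<le> a + \<beta>0 / (2 * (real k + 1)\<^sup>2) \<and>
         (a = \<beta> k \<or> a powr (1 - \<theta>) * (a - \<beta> k) powr \<theta> \<le> W * (real k + 1) powr (2 * \<theta>)))"
  shows "\<beta> K \<le> (3 * \<beta>0 + 6 * W) * real K powr (3 * \<theta>)"
proof -
  \<comment> \<open>The bisection tolerances are summable with sum at most \<open>\<beta>0\<close>; they are removed from \<open>\<beta>\<close>.\<close>
  define T where "T k = (\<Sum>j<k. \<beta>0 / (2 * (real j + 1)\<^sup>2))" for k
  define B where "B k = \<beta> k - T k" for k
  have T_le: "T k \<le> \<beta>0" for k
  proof -
    have "T k = \<beta>0 * (\<Sum>j<k. 1 / (2 * (real j + 1)\<^sup>2))"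
      by (simp add: T_def sum_distrib_left)
    then show ?thesis
      using mult_left_mono[OF sum_half_inverse_squares_le, of \<beta>0 k] \<beta>0 by simp
  qed
  have T_nonneg: "0 \<le> T k" for k
    using \<beta>0 by (auto simp: T_def intro!: sum_nonneg)
  have T_Suc: "T (Suc k) = T k + \<beta>0 / (2 * (real k + 1)\<^sup>2)" for k
    by (simp add: T_def)
  have B_nonneg: "0 \<le> B k" if "k \<le> K" for k
    using T_le[of k] ge[OF that] by (simp add: B_def)
  have B_step: "B (Suc k) \<le> B k \<or>
      (\<exists>a. \<beta> k < a \<and> B (Suc k) \<le> a \<and> B (Suc k) - B k \<le> a - \<beta> k \<and>
         a powr (1 - \<theta>) * (a - \<beta> k) powr \<theta> \<le> W * (real k + 1) powr (2 * \<theta>))" if "k < K" for k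
  proof -
    have tol: "0 \<le> \<beta>0 / (2 * (real k + 1)\<^sup>2)"
      using \<beta>0 by simp
    from step[OF that] show ?thesis
    proof
      assume "\<beta> (Suc k) = \<beta> k"
      then show ?thesis
        using tol by (simp add: B_def T_Suc)
    next
      assume "\<exists>a\<ge>\<beta> k. \<beta> (Suc k) \<le> a + \<beta>0 / (2 * (real k + 1)\<^sup>2) \<and>
         (a = \<beta> k \<or> a powr (1 - \<theta>) * (a - \<beta> k) powr \<theta> \<le> W * (real k + 1) powr (2 * \<theta>))"
      then obtain a where a: "\<beta> k \<le> a" "\<beta> (Suc k) \<le> a + \<beta>0 / (2 * (real k + 1)\<^sup>2)"
        "a = \<beta> k \<or> a powr (1 - \<theta>) * (a - \<beta> k) powr \<theta> \<le> W * (real k + 1) powr (2 * \<theta>)"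
        by blast
      have "B (Suc k) \<le> a" "B (Suc k) - B k \<le> a - \<beta> k"
        using a(2) T_nonneg[of k] by (auto simp: B_def T_Suc)
      then show ?thesis
        using a by (cases "a = \<beta> k") auto
    qed
  qed
  have B0: "B 0 = \<beta>0"
    using \<beta>0 by (simp add: B_def T_def)
  have "B K \<le> 2 * (\<beta>0 + 3 * W) * real K powr (3 * \<theta>)"
  proof (cases "\<theta> = 0")
    case True
    have "B k \<le> \<beta>0 + W" if "k \<le> K" for k
      using that
    proof (induction k)
      case 0
      then show ?case using B0 W by simp
    next
      case (Suc k)
      have "B (Suc k) \<le> B k \<or> B (Suc k) \<le> W"
        using B_step[of k] Suc.prems True ge[of k] \<beta>0 by (auto split: if_splits)
      then show ?case
        using Suc \<beta>0 by auto
    qed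
    from this[of K] show ?thesis
      using True K W \<beta>0 by simp
  next
    case False
    define q where "q = 1 / \<theta>"
    have q: "2 \<le> q" "\<theta> * q = 1"
      using \<theta> False by (auto simp: q_def field_simps)
    have q_exp: "q \<le> 3 powr q"
    proof -
      have "q \<le> exp q"
        using exp_ge_add_one_self[of q] by linarith
      also have "\<dots> = exp 1 powr q"
        by (simp add: powr_def)
      also have "\<dots> \<le> 3 powr q"
        using q exp_le by (intro powr_mono2) auto
      finally show ?thesis .
    qed
    have incr: "B (Suc k) powr q \<le> B k powr q + (3 * W) powr q * (real k + 1)\<^sup>2" if "k < K" for k
      using B_step[OF that]
    proof
      assume "B (Suc k) \<le> B k"
      then have "B (Suc k) powr q \<le> B k powr q"
        using B_nonneg[of "Suc k"] that q by (intro powr_mono2) auto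
      then show ?thesis
        by (smt (verit) mult_nonneg_nonneg powr_ge_zero zero_le_power2)
    next
      assume "\<exists>a. \<beta> k < a \<and> B (Suc k) \<le> a \<and> B (Suc k) - B k \<le> a - \<beta> k \<and>
         a powr (1 - \<theta>) * (a - \<beta> k) powr \<theta> \<le> W * (real k + 1) powr (2 * \<theta>)"
      then obtain a where a: "\<beta> k < a" "B (Suc k) \<le> a" "B (Suc k) - B k \<le> a - \<beta> k"
         "a powr (1 - \<theta>) * (a - \<beta> k) powr \<theta> \<le> W * (real k + 1) powr (2 * \<theta>)"
        by blast
      have a_pos: "0 < a"
        using a ge[of k] that \<beta>0 by simp
      have "(a powr (1 - \<theta>) * (a - \<beta> k) powr \<theta>) powr q \<le> (W * (real k + 1) powr (2 * \<theta>)) powr q"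
        using a q by (intro powr_mono2) auto
      moreover have "(a powr (1 - \<theta>) * (a - \<beta> k) powr \<theta>) powr q = a powr (q - 1) * (a - \<beta> k)"
        using a q by (simp add: powr_mult powr_powr algebra_simps)
      moreover have "(W * (real k + 1) powr (2 * \<theta>)) powr q = W powr q * (real k + 1)\<^sup>2"
      proof -
        have "((real k + 1) powr (2 * \<theta>)) powr q = (real k + 1) powr (2 * (\<theta> * q))"
          by (simp add: powr_powr mult.assoc)
        then show ?thesis
          using W q by (simp add: powr_mult)
      qed
      ultimately have key: "a powr (q - 1) * (a - \<beta> k) \<le> W powr q * (real k + 1)\<^sup>2"
        by simp
      show ?thesis
      proof (cases "B (Suc k) \<le> B k")
        case True
        then have "B (Suc k) powr q \<le> B k powr q"
          using B_nonneg[of "Suc k"] that q by (intro powr_mono2) auto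
        then show ?thesis
          by (smt (verit) mult_nonneg_nonneg powr_ge_zero zero_le_power2)
      next
        case False
        have "B (Suc k) powr q - B k powr q \<le> q * B (Suc k) powr (q - 1) * (B (Suc k) - B k)"
          using B_nonneg[of k] that False q by (intro powr_diff_le) auto
        also have "\<dots> \<le> q * a powr (q - 1) * (a - \<beta> k)"
          using a False B_nonneg[of "Suc k"] that q
          by (intro mult_mono mult_left_mono powr_mono2) auto
        also have "\<dots> \<le> 3 powr q * (W powr q * (real k + 1)\<^sup>2)"
        proof -
          have "q * (a powr (q - 1) * (a - \<beta> k)) \<le> 3 powr q * (W powr q * (real k + 1)\<^sup>2)"
            using mult_mono[OF q_exp key] a q by simp
          then show ?thesis by (simp add: mult.assoc)
        qed
        also have "\<dots> = (3 * W) powr q * (real k + 1)\<^sup>2"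
          using W by (simp add: powr_mult)
        finally show ?thesis by simp
      qed
    qed
    have "B k powr q \<le> \<beta>0 powr q + (3 * W) powr q * real k ^ 3" if "k \<le> K" for k
      using that
    proof (induction k)
      case 0
      then show ?case using B0 by simp
    next
      case (Suc k)
      have "real k ^ 3 + (real k + 1)\<^sup>2 \<le> real (Suc k) ^ 3"
        by (simp add: power2_eq_square power3_eq_cube algebra_simps)
      then have "(3 * W) powr q * (real k ^ 3 + (real k + 1)\<^sup>2) \<le> (3 * W) powr q * real (Suc k) ^ 3"
        by (intro mult_left_mono) auto
      then show ?case
        using Suc incr[of k] by (simp only: distrib_left) (use Suc incr[of k] in linarith)
    qed
    from this[of K] have "B K powr q \<le> \<beta>0 powr q + (3 * W) powr q * real K ^ 3"
      by simp
    also have "\<dots> \<le> (\<beta>0 + 3 * W) powr q * real K ^ 3 + (\<beta>0 + 3 * W) powr q * real K ^ 3"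
    proof (rule add_mono)
      have "\<beta>0 powr q * 1 \<le> (\<beta>0 + 3 * W) powr q * real K ^ 3"
        using K W \<beta>0 q by (intro mult_mono powr_mono2 one_le_power) auto
      then show "\<beta>0 powr q \<le> (\<beta>0 + 3 * W) powr q * real K ^ 3" by simp
      show "(3 * W) powr q * real K ^ 3 \<le> (\<beta>0 + 3 * W) powr q * real K ^ 3"
        using W \<beta>0 q by (intro mult_right_mono powr_mono2) auto
    qed
    also have "\<dots> = 2 * ((\<beta>0 + 3 * W) powr q * real K powr 3)"
      using K by (simp add: powr_realpow)
    finally have "(B K powr q) powr \<theta> \<le> (2 * ((\<beta>0 + 3 * W) powr q * real K powr 3)) powr \<theta>"
      using \<theta> by (intro powr_mono2) auto
    then have "B K \<le> 2 powr \<theta> * ((\<beta>0 + 3 * W) * real K powr (3 * \<theta>))"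
      using B_nonneg[of K] q W \<beta>0 by (simp add: powr_powr powr_mult mult.commute[of q] del: powr_numeral)
    also have "\<dots> \<le> 2 powr 1 * ((\<beta>0 + 3 * W) * real K powr (3 * \<theta>))"
      using \<theta> W \<beta>0 by (intro mult_right_mono powr_mono) auto
    finally show ?thesis by (simp add: algebra_simps)
  qed
  moreover have "\<beta> K \<le> B K + \<beta>0"
    using T_le[of K] by (simp add: B_def)
  moreover have "\<beta>0 * 1 \<le> \<beta>0 * real K powr (3 * \<theta>)"
    using K \<theta> \<beta>0 by (intro mult_left_mono ge_one_powr_ge_zero) auto
  ultimately show ?thesis
    by (simp add: algebra_simps)
qed

section \<open>Line search by doubling and bisection\<close>

lemma bisection_spec:
  fixes l :: "real \<Rightarrow> real"
  assumes "0 < tol" "a0 \<le> b0" "l a0 < 0" "0 \<le> l b0"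
  shows "0 \<le> l (bisection l tol a0 b0) \<and>
    (\<exists>a. a0 \<le> a \<and> a \<le> bisection l tol a0 b0 \<and> l a < 0 \<and> bisection l tol a0 b0 \<le> a + tol)"
proof -
  let ?b = "\<lambda>(a, b). b - a > tol"
  let ?c = "\<lambda>(a, b). let m = (a + b) / 2 in if l m < 0 then (m, b) else (a, m)"
  let ?P = "\<lambda>(a, b). a0 \<le> a \<and> a \<le> b \<and> l a < 0 \<and> 0 \<le> l b"
  let ?Q = "\<lambda>s. ?P s \<and> snd s - fst s \<le> tol"
  \<comment> \<open>The number of tolerances that fit into the interval, rounded up, decreases when the interval
    is halved.\<close>
  have halve: "nat \<lceil>u / 2\<rceil> < nat \<lceil>u\<rceil>" if "1 < u" for u :: real
  proof -
    have "2 \<le> \<lceil>u\<rceil>" using that by linarith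
    moreover have "\<lceil>u / 2\<rceil> < \<lceil>u\<rceil>"
    proof -
      have "u / 2 \<le> of_int (\<lceil>u\<rceil> - 1)"
        using \<open>2 \<le> \<lceil>u\<rceil>\<close> by linarith
      then show ?thesis
        by (simp only: ceiling_le_iff[symmetric])
    qed
    ultimately show ?thesis by linarith
  qed
  have "?Q (while ?b ?c (a0, b0))"
  proof (rule while_rule[where P = ?P and r = "Wellfounded.measure (\<lambda>(a, b). nat \<lceil>(b - a) / tol\<rceil>)"])
    show "?P (a0, b0)" using assms by simp
  next
    fix s assume "?P s" "?b s"
    then show "?P (?c s)"
      using \<open>0 < tol\<close> by (auto simp: Let_def split: if_splits)
  next
    fix s assume "?P s" "\<not> ?b s"
    then show "?Q s" by (auto simp: split: prod.splits)
  next
    fix s assume s: "?P s" "?b s"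
    obtain a b where ab: "s = (a, b)" by (cases s)
    have "1 < (b - a) / tol"
      using s ab \<open>0 < tol\<close> by simp
    from halve[OF this] show "(?c s, s) \<in> Wellfounded.measure (\<lambda>(a, b). nat \<lceil>(b - a) / tol\<rceil>)"
      using ab by (auto simp: Let_def field_simps split: if_splits)
  qed simp
  then show ?thesis
    unfolding bisection_def by (cases "while ?b ?c (a0, b0)") (auto simp: algebra_simps)
qed

text \<open>The rejected value close to the accepted one is what later limits the growth of \<open>\<beta>\<close>: acceptance alone
gives no upper bound. The starting interval of the bisection already has a rejected left end, since
the doubling stage stops at the first acceptance.\<close>

lemma line_search_spec:
  fixes l :: "real \<Rightarrow> real"
  assumes tol: "0 < tol" and b: "0 < b" and ex: "\<exists>n. 0 \<le> l (2 ^ n * b)"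
  shows "0 \<le> l (line_search l tol b)" "b \<le> line_search l tol b"
    "line_search l tol b = b \<or>
      (\<exists>a. b \<le> a \<and> a \<le> line_search l tol b \<and> l a < 0 \<and> line_search l tol b \<le> a + tol)"
proof -
  define i where "i = (LEAST i. 1 \<le> i \<and> 0 \<le> l (2 ^ (i - 1) * b))"
  have "\<exists>i. 1 \<le> i \<and> 0 \<le> l (2 ^ (i - 1) * b)"
    using ex by (metis diff_Suc_1 le_add1 plus_1_eq_Suc)
  then have i: "1 \<le> i" "0 \<le> l (2 ^ (i - 1) * b)"
    unfolding i_def by (metis (mono_tags, lifting) LeastI_ex)+
  have res: "line_search l tol b =
      (if i = 1 then b else bisection l tol (2 ^ (i - 2) * b) (2 ^ (i - 1) * b))"
    by (simp add: line_search_def i_def Let_def)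
  have "0 \<le> l (line_search l tol b) \<and> b \<le> line_search l tol b \<and>
    (line_search l tol b = b \<or>
      (\<exists>a. b \<le> a \<and> a \<le> line_search l tol b \<and> l a < 0 \<and> line_search l tol b \<le> a + tol))"
  proof (cases "i = 1")
    case True
    then show ?thesis using res i by simp
  next
    case False
    then have i2: "2 \<le> i" using i by simp
    have "\<not> (1 \<le> i - 1 \<and> 0 \<le> l (2 ^ (i - 1 - 1) * b))"
      unfolding i_def by (rule not_less_Least) (use i2 i_def in simp)
    moreover have "i - 1 - 1 = i - 2" "1 \<le> i - 1"
      using i2 by auto
    ultimately have "l (2 ^ (i - 2) * b) < 0"
      by simp
    moreover have "2 ^ (i - 2) * b \<le> 2 ^ (i - 1) * b"
      using b by (intro mult_right_mono power_increasing) auto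
    ultimately have spec: "0 \<le> l (line_search l tol b)"
        "\<exists>a. 2 ^ (i - 2) * b \<le> a \<and> a \<le> line_search l tol b \<and> l a < 0 \<and> line_search l tol b \<le> a + tol"
      using bisection_spec[OF tol] i res False by auto
    moreover have "1 * b \<le> 2 ^ (i - 2) * b"
      using b by (intro mult_right_mono) auto
    ultimately show ?thesis
      by (metis mult_1 order_trans)
  qed
  then show "0 \<le> l (line_search l tol b)" "b \<le> line_search l tol b"
    "line_search l tol b = b \<or>
      (\<exists>a. b \<le> a \<and> a \<le> line_search l tol b \<and> l a < 0 \<and> line_search l tol b \<le> a + tol)"
    by blast+
qed

section \<open>Proximal minimization\<close>

text \<open>The quadratic term makes the regularized function strongly convex. Comparing \<open>w\<close> with the points
\<open>t w + (1 - t) z\<close>, dividing by \<open>1 - t\<close> and letting \<open>t\<close> tend to \<open>1\<close> yields the extra quadratic term.\<close>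

lemma proximal_three_point:
  fixes F :: "'a::real_inner \<Rightarrow> real"
  assumes F: "convex_on D F" and w: "w \<in> D" and z: "z \<in> D"
    and min: "\<And>u. u \<in> D \<Longrightarrow> F w + b / 2 * (norm (w - x0))\<^sup>2 \<le> F u + b / 2 * (norm (u - x0))\<^sup>2"
  shows "F w + b / 2 * (norm (w - x0))\<^sup>2 + b / 2 * (norm (z - w))\<^sup>2
    \<le> F z + b / 2 * (norm (z - x0))\<^sup>2"
proof -
  let ?c = "b / 2 * (norm (z - w))\<^sup>2"
  let ?d = "F z + b / 2 * (norm (z - x0))\<^sup>2 - (F w + b / 2 * (norm (w - x0))\<^sup>2)"
  have "t * ?c \<le> ?d" if t: "0 < t" "t < 1" for t :: real
  proof -
    let ?u = "t *\<^sub>R w + (1 - t) *\<^sub>R z"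
    have D: "?u \<in> D"
      using F w z t by (auto simp: convex_on_def convex_def)
    have Fu: "F ?u \<le> t * F w + (1 - t) * F z"
      using F w z t by (auto simp: convex_on_def)
    have "?u - x0 = t *\<^sub>R (w - x0) + (1 - t) *\<^sub>R (z - x0)"
      by (simp add: algebra_simps)
    moreover have "(norm (t *\<^sub>R p + (1 - t) *\<^sub>R p'))\<^sup>2 =
        t * (norm p)\<^sup>2 + (1 - t) * (norm p')\<^sup>2 - t * (1 - t) * (norm (p' - p))\<^sup>2" for p p' :: 'a
      unfolding power2_norm_eq_inner
      by (simp add: inner_add_left inner_add_right inner_diff_left inner_diff_right inner_commute
          algebra_simps)
    ultimately have nu: "(norm (?u - x0))\<^sup>2 = t * (norm (w - x0))\<^sup>2 + (1 - t) * (norm (z - x0))\<^sup>2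
        - t * (1 - t) * (norm (z - w))\<^sup>2"
      by simp
    have "F w + b / 2 * (norm (w - x0))\<^sup>2 \<le> t * F w + (1 - t) * F z + b / 2 * (norm (?u - x0))\<^sup>2"
      using min[OF D] Fu by linarith
    then have "(1 - t) * (t * ?c) \<le> (1 - t) * ?d"
      unfolding nu by (simp add: algebra_simps add_divide_distrib diff_divide_distrib)
    then show ?thesis
      using t by simp
  qed
  then have "?c \<le> ?d"
    by (rule field_le_mult_one_interval)
  then show ?thesis by simp
qed

text \<open>Adding the three-point inequalities of the two minimizers, each evaluated at the other one, eliminates
\<open>F\<close>.\<close>

lemma proximal_path_stable:
  fixes F :: "'a::real_inner \<Rightarrow> real"
  assumes F: "convex_on D F" and w: "wa \<in> D" "wb \<in> D" and ab: "0 < a" "a \<le> b"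
    and mina: "\<And>u. u \<in> D \<Longrightarrow> F wa + a / 2 * (norm (wa - x0))\<^sup>2 \<le> F u + a / 2 * (norm (u - x0))\<^sup>2"
    and minb: "\<And>u. u \<in> D \<Longrightarrow> F wb + b / 2 * (norm (wb - x0))\<^sup>2 \<le> F u + b / 2 * (norm (u - x0))\<^sup>2"
  shows "norm (wb - x0) \<le> norm (wa - x0)"
    and "a * norm (wa - wb) \<le> (b - a) * norm (wb - x0)"
proof -
  let ?d = "norm (wa - wb)" and ?p = "norm (wa - x0)" and ?q = "norm (wb - x0)"
  have "F wa + a / 2 * ?p\<^sup>2 + a / 2 * ?d\<^sup>2 \<le> F wb + a / 2 * ?q\<^sup>2"
    using proximal_three_point[OF F w mina] by (simp add: norm_minus_commute)
  moreover have "F wb + b / 2 * ?q\<^sup>2 + b / 2 * ?d\<^sup>2 \<le> F wa + b / 2 * ?p\<^sup>2"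
    using proximal_three_point[OF F w(2) w(1) minb] .
  ultimately have main: "(a + b) * ?d\<^sup>2 \<le> (b - a) * (?p\<^sup>2 - ?q\<^sup>2)"
    by (simp add: algebra_simps)
  show "?q \<le> ?p"
  proof (cases "a = b")
    case True
    then have "wa = wb"
      using main ab by (auto simp: mult_le_0_iff)
    then show ?thesis by simp
  next
    case False
    have "0 \<le> (a + b) * ?d\<^sup>2"
      using ab by simp
    then have "(b - a) * 0 \<le> (b - a) * (?p\<^sup>2 - ?q\<^sup>2)"
      using main by linarith
    moreover have "0 < b - a"
      using ab False by simp
    ultimately have "0 \<le> ?p\<^sup>2 - ?q\<^sup>2"
      by (rule mult_left_le_imp_le)
    then have "?q\<^sup>2 \<le> ?p\<^sup>2"
      by linarith
    then show ?thesis
      by (rule power2_le_imp_le) (rule norm_ge_zero)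
  qed
  have "?p \<le> ?d + ?q"
    using norm_triangle_ineq[of "wa - wb" "wb - x0"] by simp
  then have "?p\<^sup>2 \<le> (?d + ?q)\<^sup>2"
    by (intro power_mono) auto
  then have "(b - a) * (?p\<^sup>2 - ?q\<^sup>2) \<le> (b - a) * (?d\<^sup>2 + 2 * ?d * ?q)"
    using ab by (intro mult_left_mono) (auto simp: power2_sum)
  then have "(a + b) * ?d\<^sup>2 \<le> (b - a) * (?d\<^sup>2 + 2 * ?d * ?q)"
    using main by linarith
  then have "?d * (a * ?d) \<le> ?d * ((b - a) * ?q)"
    by (simp add: algebra_simps power2_eq_square)
  then show "a * ?d \<le> (b - a) * ?q"
    using ab by (cases "?d = 0") auto
qed

text \<open>If every value were undercut, the open sets on which \<open>\<Phi>\<close> exceeds some \<open>\<Phi> y\<close> with \<open>y \<in> S\<close> would cover \<open>S\<close>; in a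
finite subcover, the \<open>y\<close> with the least value is not covered.\<close>

lemma lower_semicontinuous_attains_min:
  fixes \<Phi> :: "'a::topological_space \<Rightarrow> 'b::linorder"
  assumes "compact S" "S \<noteq> {}"
    and lsc: "\<And>z c. z \<in> S \<Longrightarrow> c < \<Phi> z \<Longrightarrow> eventually (\<lambda>w. c < \<Phi> w) (nhds z)"
  shows "\<exists>z\<in>S. \<forall>w\<in>S. \<Phi> z \<le> \<Phi> w"
proof (rule ccontr)
  assume "\<not> ?thesis"
  then have "\<forall>z\<in>S. \<exists>y\<in>S. \<Phi> y < \<Phi> z"
    by (force simp: not_le)
  then obtain y where y: "\<And>z. z \<in> S \<Longrightarrow> y z \<in> S \<and> \<Phi> (y z) < \<Phi> z"
    by metis
  then have "\<forall>z\<in>S. \<exists>U. open U \<and> z \<in> U \<and> (\<forall>w\<in>U. \<Phi> (y z) < \<Phi> w)"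
    using lsc by (simp add: eventually_nhds)
  then obtain U where U: "\<And>z. z \<in> S \<Longrightarrow> open (U z) \<and> z \<in> U z \<and> (\<forall>w\<in>U z. \<Phi> (y z) < \<Phi> w)"
    by metis
  obtain C where C: "C \<subseteq> S" "finite C" "S \<subseteq> (\<Union>z\<in>C. U z)"
    using compactE_image[OF \<open>compact S\<close>, of S U] U by (smt (verit) UN_iff subsetI)
  then have "C \<noteq> {}" using \<open>S \<noteq> {}\<close> by auto
  then have "Min ((\<lambda>z. \<Phi> (y z)) ` C) \<in> (\<lambda>z. \<Phi> (y z)) ` C"
    using C by (intro Min_in) auto
  then obtain z0 where z0: "z0 \<in> C" "\<Phi> (y z0) = Min ((\<lambda>z. \<Phi> (y z)) ` C)"
    by auto
  obtain z1 where z1: "z1 \<in> C" "y z0 \<in> U z1"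
    using y[of z0] z0 C by blast
  then have "\<Phi> (y z1) < \<Phi> (y z0)"
    using U C by blast
  moreover have "\<Phi> (y z0) \<le> \<Phi> (y z1)"
    using z0 z1 C by simp
  ultimately show False by simp
qed

lemma lsc_fun_eventually:
  assumes "lsc_fun g" "c < g z"
  shows "eventually (\<lambda>w. c < g w) (nhds z)"
proof -
  have "c < Liminf (at z) g"
    using assms by (auto simp: lsc_fun_def intro: less_le_trans)
  then show ?thesis
    using assms less_LiminfD[of c "at z" g]
    by (auto simp: eventually_nhds_conv_at)
qed

text \<open>A convex function that is bounded below near one point of its domain decreases at most linearly along
rays, so the quadratic term dominates far away. Lower semicontinuity provides both that local bound and
the minimum over a sufficiently large ball.\<close>

lemma regularized_min_exists:
  fixes g :: "'a::euclidean_space \<Rightarrow> ereal" and p x0 :: 'a and A b :: real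
  assumes proper: "proper_fun g" and lsc: "lsc_fun g" and conv: "convex_ereal_fun g"
    and A: "0 < A" and b: "0 < b"
  shows "\<exists>w. \<forall>z. ereal (p \<bullet> w) + ereal A * g w + ereal (b / 2 * (norm (w - x0))\<^sup>2)
    \<le> ereal (p \<bullet> z) + ereal A * g z + ereal (b / 2 * (norm (z - x0))\<^sup>2)"
proof -
  define q where "q z = p \<bullet> z + b / 2 * (norm (z - x0))\<^sup>2" for z
  define \<Phi> where
    "\<Phi> z = ereal (p \<bullet> z) + ereal A * g z + ereal (b / 2 * (norm (z - x0))\<^sup>2)" for z
  have not_minf: "g z \<noteq> -\<infinity>" for z
    using proper by (simp add: proper_fun_def)
  have \<Phi>_real: "\<Phi> z = ereal (q z + A * h)" if "g z = ereal h" for z h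
    using that by (simp add: \<Phi>_def q_def)
  have \<Phi>_inf: "\<Phi> z = \<infinity>" if "g z = \<infinity>" for z
    using that A by (simp add: \<Phi>_def)
  have \<Phi>_ge: "ereal (q z + A * h) \<le> \<Phi> z" if "ereal h \<le> g z" for z h
    using that not_minf[of z] \<Phi>_real[of z] \<Phi>_inf[of z] A by (cases "g z") auto
  have \<Phi>_gt: "ereal (q z + A * h) < \<Phi> z" if "ereal h < g z" for z h
    using that not_minf[of z] \<Phi>_real[of z] \<Phi>_inf[of z] A by (cases "g z") auto
  obtain z0 c0 where z0: "g z0 = ereal c0"
    using proper not_minf unfolding proper_fun_def by (metis ereal_cases)
  obtain \<mu> where \<mu>: "\<And>w. w \<in> cball z0 1 \<Longrightarrow> ereal \<mu> \<le> g w"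
  proof -
    obtain w0 where w0: "w0 \<in> cball z0 1" "\<And>w. w \<in> cball z0 1 \<Longrightarrow> g w0 \<le> g w"
      using lower_semicontinuous_attains_min[of "cball z0 1" g] lsc_fun_eventually[OF lsc] by auto
    moreover obtain \<mu> where "g w0 = ereal \<mu>"
      using w0(2)[of z0] z0 not_minf[of w0] by (cases "g w0") auto
    ultimately show ?thesis using that by metis
  qed
  \<comment> \<open>By convexity along rays from \<open>z0\<close>, \<open>g\<close> decreases at most linearly.\<close>
  have linear: "ereal (- (\<bar>\<mu>\<bar> + \<bar>c0\<bar>) * norm (z - z0)) \<le> g z" if z: "1 < norm (z - z0)" for z
  proof (cases "g z")
    case (real h)
    let ?t = "norm (z - z0)"
    have "z0 - ((1 - 1 / ?t) *\<^sub>R z0 + (1 / ?t) *\<^sub>R z) = (1 / ?t) *\<^sub>R (z0 - z)"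
      by (simp add: algebra_simps)
    then have "dist z0 ((1 - 1 / ?t) *\<^sub>R z0 + (1 / ?t) *\<^sub>R z) = norm ((1 / ?t) *\<^sub>R (z0 - z))"
      unfolding dist_norm by (rule arg_cong)
    then have "dist z0 ((1 - 1 / ?t) *\<^sub>R z0 + (1 / ?t) *\<^sub>R z) \<le> 1"
      using z by (simp add: norm_minus_commute)
    then have "ereal \<mu> \<le> g ((1 - 1 / ?t) *\<^sub>R z0 + (1 / ?t) *\<^sub>R z)"
      by (intro \<mu>) auto
    also have "\<dots> \<le> ereal (1 - 1 / ?t) * g z0 + ereal (1 / ?t) * g z"
      using z by (intro conv[unfolded convex_ereal_fun_def, rule_format]) (auto simp: divide_less_eq)
    finally have "\<mu> \<le> (1 - 1 / ?t) * c0 + (1 / ?t) * h"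
      using z0 real by simp
    then have "?t * \<mu> \<le> ?t * ((1 - 1 / ?t) * c0 + (1 / ?t) * h)"
      using z by (intro mult_left_mono) auto
    moreover have "?t * ((1 - 1 / ?t) * c0 + (1 / ?t) * h) = (?t - 1) * c0 + h"
      using z by (auto simp: field_simps)
    ultimately have "?t * \<mu> - (?t - 1) * c0 \<le> h" by simp
    moreover have "(?t - 1) * c0 \<le> (?t - 1) * \<bar>c0\<bar>"
      using z by (intro mult_left_mono) auto
    then have "(?t - 1) * c0 \<le> ?t * \<bar>c0\<bar>"
      unfolding left_diff_distrib by linarith
    moreover have "- (?t * \<bar>\<mu>\<bar>) \<le> ?t * \<mu>"
      using z by (smt (verit) mult_left_mono mult_minus_right)
    ultimately show ?thesis
      using real by (simp add: algebra_simps)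
  qed (use not_minf in auto)
  define \<delta> where "\<delta> = norm (z0 - x0)"
  \<comment> \<open>At distance \<open>t > \<rho>\<close> from \<open>z0\<close> one has \<open>b / 2 * t\<^sup>2 \<ge> c1 * t + c2\<close>; the lower bound for \<open>\<Phi>\<close>
    contributes its linear terms to \<open>c1\<close>, and \<open>c2\<close> exceeds its constants by more than the value at \<open>z0\<close>.\<close>
  define c1 where "c1 = b * \<delta> + norm p + A * (\<bar>\<mu>\<bar> + \<bar>c0\<bar>)"
  define c2 where "c2 = 1 + \<bar>q z0 + A * c0\<bar> + norm p * norm z0"
  define \<rho> where "\<rho> = 1 + 2 / b * (c1 + c2)"
  have c: "0 \<le> c1" "1 \<le> c2" "0 \<le> \<delta>"
    using A b by (auto simp: c1_def c2_def \<delta>_def)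
  have \<rho>: "1 \<le> \<rho>" using c b by (simp add: \<rho>_def)
  have far: "\<Phi> z0 < \<Phi> z" if z: "\<rho> < norm (z - z0)" for z
  proof -
    define t where "t = norm (z - z0)"
    have t: "1 < t" "\<rho> < t" using z \<rho> by (auto simp: t_def)
    have pz: "- (norm p * (norm z0 + t)) \<le> p \<bullet> z"
    proof -
      have "\<bar>p \<bullet> z\<bar> \<le> norm p * norm z" by (rule Cauchy_Schwarz_ineq2)
      also have "\<dots> \<le> norm p * (norm z0 + t)"
        using norm_triangle_ineq[of z0 "z - z0"] by (intro mult_left_mono) (auto simp: t_def)
      finally show ?thesis by linarith
    qed
    have tri: "t - \<delta> \<le> norm (z - x0)"
      using norm_triangle_ineq[of "z - x0" "x0 - z0"] by (simp add: t_def \<delta>_def norm_minus_commute)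
    have sq: "t\<^sup>2 - 2 * t * \<delta> \<le> (norm (z - x0))\<^sup>2"
    proof (cases "\<delta> \<le> t")
      case True
      then have "(t - \<delta>)\<^sup>2 \<le> (norm (z - x0))\<^sup>2"
        using tri by (intro power_mono) auto
      then show ?thesis by (simp add: power2_diff) (smt (verit) zero_le_power2)
    next
      case False
      then have "t * t \<le> t * (2 * \<delta>)"
        using t by (intro mult_left_mono) auto
      then have "t\<^sup>2 - 2 * t * \<delta> \<le> 0"
        by (simp add: power2_eq_square mult_ac)
      also have "0 \<le> (norm (z - x0))\<^sup>2"
        by simp
      finally show ?thesis .
    qed
    have "c1 + c2 \<le> b / 2 * t"
      using t b by (simp add: \<rho>_def field_simps)
    then have "c2 \<le> 1 * (b / 2 * t - c1)"
      by simp
    also have "\<dots> \<le> t * (b / 2 * t - c1)"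
      using \<open>c1 + c2 \<le> b / 2 * t\<close> t c by (intro mult_right_mono) auto
    finally have "c2 \<le> t * (b / 2 * t - c1)" .
    then have "\<bar>q z0 + A * c0\<bar> + norm p * norm z0
        < b / 2 * (t\<^sup>2 - 2 * t * \<delta>) - norm p * t - A * ((\<bar>\<mu>\<bar> + \<bar>c0\<bar>) * t)"
      by (simp add: c1_def c2_def algebra_simps power2_eq_square)
    moreover have "b / 2 * (t\<^sup>2 - 2 * t * \<delta>) \<le> b / 2 * (norm (z - x0))\<^sup>2"
      using sq b by (intro mult_left_mono) auto
    ultimately have "q z0 + A * c0 < q z + A * (- (\<bar>\<mu>\<bar> + \<bar>c0\<bar>) * t)"
      using pz abs_ge_self[of "q z0 + A * c0"] unfolding q_def[of z] by (simp add: algebra_simps)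
    then have "\<Phi> z0 < ereal (q z + A * (- (\<bar>\<mu>\<bar> + \<bar>c0\<bar>) * t))"
      using \<Phi>_real[OF z0] by simp
    also have "\<dots> \<le> \<Phi> z"
      using \<Phi>_ge[OF linear[of z]] t by (simp add: t_def)
    finally show ?thesis .
  qed
  have q_cont: "isCont q z" for z
    unfolding q_def by (intro continuous_intros)
  have "eventually (\<lambda>w. c < \<Phi> w) (nhds z)" if cz: "c < \<Phi> z" for z c
  proof -
    obtain h where h: "c < ereal (q z + A * h)" "ereal h < g z"
    proof (cases "g z")
      case (real h)
      then obtain e where "c < ereal e" "ereal e < \<Phi> z"
        using cz \<Phi>_real ereal_dense2 by blast
      then show ?thesis
        using that[of "(e - q z) / A"] real \<Phi>_real[OF real] A by (simp add: field_simps)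
    next
      case PInf
      then obtain e where "c < ereal e"
        using cz \<Phi>_inf less_PInf_Ex_of_nat by (metis ereal_dense2)
      then show ?thesis
        using that[of "(e - q z) / A"] PInf A by simp
    qed (use not_minf in auto)
    have "((\<lambda>w. ereal (q w + A * h)) \<longlongrightarrow> ereal (q z + A * h)) (nhds z)"
      using q_cont[of z] by (auto intro!: tendsto_intros simp: isCont_def tendsto_nhds_iff)
    then have "eventually (\<lambda>w. c < ereal (q w + A * h)) (nhds z)"
      using h(1) by (rule order_tendstoD)
    then show ?thesis
      using lsc_fun_eventually[OF lsc h(2)]
      by eventually_elim (use \<Phi>_gt in \<open>auto intro: less_trans\<close>)
  qed
  then have "\<exists>w\<in>cball z0 \<rho>. \<forall>u\<in>cball z0 \<rho>. \<Phi> w \<le> \<Phi> u"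
    using \<rho> by (intro lower_semicontinuous_attains_min) auto
  then obtain w where w: "\<And>u. u \<in> cball z0 \<rho> \<Longrightarrow> \<Phi> w \<le> \<Phi> u"
    by blast
  have "\<Phi> w \<le> \<Phi> z" for z
  proof (cases "norm (z - z0) \<le> \<rho>")
    case True
    then show ?thesis by (intro w) (simp add: dist_norm norm_minus_commute)
  next
    case False
    then show ?thesis
      using far[of z] w[of z0] \<rho> by (auto intro: order_trans less_imp_le)
  qed
  then show ?thesis
    unfolding \<Phi>_def by blast
qed

section \<open>Weights and radii of a run\<close>

locale agda_iteration =
  fixes f :: "'a::euclidean_space \<Rightarrow> real" and g :: "'a \<Rightarrow> ereal" and G :: "'a \<Rightarrow> 'a"
    and xs x0 :: 'a and \<nu> M r \<beta>0 :: real and K :: nat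
    and x v y :: "nat \<Rightarrow> 'a" and \<beta> :: "nat \<Rightarrow> real"
  assumes f_cont: "continuous_on UNIV f"
    and subgradient: "subgradient_selection f G"
    and proper: "proper_fun g" and lsc: "lsc_fun g" and convex: "convex_ereal_fun g"
    and minimizer: "is_arg_min (psi f g) (\<lambda>_. True) xs"
    and \<nu>: "0 \<le> \<nu>" "\<nu> \<le> 1" and M: "0 < M"
    and holder: "holder_smooth_on (cball xs (3 * norm (x0 - xs))) \<nu> M G"
    and r: "0 < r" "r \<le> 4 * norm (x0 - xs)"
    and \<beta>0: "0 < \<beta>0"
    and run: "agda_run f g G x0 r \<beta>0 K x v y \<beta>"
begin

abbreviation "D0 \<equiv> norm (x0 - xs)"
abbreviation "R \<equiv> agda_rbar r x0 v"
abbreviation "R_prev \<equiv> agda_rbar_prev r x0 v"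
abbreviation "S k \<equiv> \<Sum>i<k. sqrt (R i)"
abbreviation "A \<equiv> agda_A r x0 v"
abbreviation "a \<equiv> agda_a r x0 v"
abbreviation "\<tau> \<equiv> agda_tau r x0 v"
abbreviation "V \<equiv> agda_v g G x0 r x v"
abbreviation "Y \<equiv> agda_y g G x0 r x v y"
abbreviation "l \<equiv> agda_l f g G x0 r x v y \<beta>"
abbreviation "dom_g \<equiv> {z. g z \<noteq> \<infinity>}"
abbreviation "h z \<equiv> real_of_ereal (g z)"

lemma D0_pos: "0 < D0"
  using r by linarith

lemma R_prev_ge: "r \<le> R_prev k"
  by (induction k) auto

lemma R_prev_le: "R_prev k \<le> R k"
  by (simp add: agda_rbar_def)

lemma R_eq_prev: "R k = R_prev (Suc k)"
  by (simp add: agda_rbar_def)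

lemma R_pos: "0 < R k"
  using R_prev_ge[of "Suc k"] r by (simp add: R_eq_prev del: agda_rbar_prev.simps)

lemma R_prev_pos: "0 < R_prev k"
  using R_prev_ge[of k] r by simp

lemma dist_v_le: "norm (v k - x0) \<le> R k"
  by (simp add: agda_rbar_def norm_minus_commute)

lemma R_mono: "i \<le> j \<Longrightarrow> R i \<le> R j"
  by (rule lift_Suc_mono_le[of R]) (auto simp: agda_rbar_def)

lemma S_nonneg: "0 \<le> S k"
  using R_pos by (intro sum_nonneg) (simp add: less_imp_le)

lemma S_Suc_pos: "0 < S (Suc k)"
  using S_nonneg[of k] R_pos[of k] by (simp add: add_nonneg_pos)

lemma A_eq: "A k = (S k)\<^sup>2"
  by (simp add: agda_A_def)

lemma A_0 [simp]: "A 0 = 0"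
  by (simp add: A_eq)

lemma A_Suc_pos: "0 < A (Suc k)"
  using S_Suc_pos[of k] unfolding A_eq by (rule zero_less_power)

lemma A_nonneg: "0 \<le> A k"
  by (simp add: A_eq)

lemma A_Suc: "A (Suc k) = A k + a (Suc k)"
  by (simp add: agda_a_def)

lemma a_eq: "a (Suc k) = 2 * sqrt (R k) * S (Suc k) - R k"
  using R_pos[of k] by (simp add: agda_a_def A_eq power2_eq_square algebra_simps)

lemma a_pos: "0 < a (Suc k)"
proof -
  have "a (Suc k) = sqrt (R k) * (2 * S k) + R k"
    using R_pos[of k] by (simp add: a_eq algebra_simps)
  then show ?thesis
    using R_pos[of k] S_nonneg[of k] by (simp add: add_nonneg_pos)
qed

lemma sum_a: "(\<Sum>i=1..k. a i) = A k"
  by (induction k) (auto simp: A_Suc)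

lemma \<tau>_eq: "\<tau> k = a (Suc k) / A (Suc k)"
  by (simp add: agda_tau_def)

lemma \<tau>_pos: "0 < \<tau> k"
  by (simp add: \<tau>_eq a_pos A_Suc_pos)

lemma \<tau>_A: "\<tau> k * A (Suc k) = a (Suc k)" "(1 - \<tau> k) * A (Suc k) = A k"
proof -
  show "\<tau> k * A (Suc k) = a (Suc k)"
    using A_Suc_pos[of k] by (simp add: \<tau>_eq)
  then show "(1 - \<tau> k) * A (Suc k) = A k"
    using A_Suc[of k] by (simp add: left_diff_distrib)
qed

lemma \<tau>_le: "\<tau> k \<le> 1"
  using A_Suc_pos[of k] A_Suc[of k] A_nonneg[of k] by (simp add: \<tau>_eq)

lemma \<tau>_0 [simp]: "\<tau> 0 = 1"
  using A_Suc_pos[of 0] A_Suc[of 0] by (simp add: \<tau>_eq)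

text \<open>In terms of \<open>s = \<surd>R\<^sub>k\<close> and \<open>w = S\<^sub>k\<^sub>+\<^sub>1 / s\<close>, one has \<open>A\<^sub>k\<^sub>+\<^sub>1 = w\<^sup>2 s\<^sup>2\<close> and
\<open>\<tau>\<^sub>k \<le> 2/w\<close>, and \<open>w \<le> k + 1\<close> because the \<open>R\<^sub>i\<close> increase.\<close>

lemma \<tau>_powr_A_le: "A (Suc k) * \<tau> k powr (1 + \<nu>) \<le> 4 * R k * (real k + 1) powr (1 - \<nu>)"
proof -
  define s where "s = sqrt (R k)"
  define w where "w = S (Suc k) / s"
  have s: "0 < s" "s * s = R k"
    using R_pos[of k] by (auto simp: s_def)
  have S: "S (Suc k) = w * s"
    using s by (simp add: w_def)
  have w1: "1 \<le> w"
    using S_nonneg[of k] s by (simp add: w_def s_def)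
  have "S (Suc k) \<le> (\<Sum>i<Suc k. s)"
    unfolding s_def by (intro sum_mono) (auto intro: R_mono)
  then have wk: "w \<le> real k + 1"
    using s by (simp add: w_def divide_le_eq algebra_simps)
  have "\<tau> k \<le> 2 / w"
  proof -
    have "a (Suc k) \<le> 2 * s * (w * s)"
      using a_eq[of k] R_pos[of k] unfolding S by (simp add: s_def)
    then have "\<tau> k \<le> 2 * s * (w * s) / (w * s)\<^sup>2"
      unfolding \<tau>_eq A_eq S by (rule divide_right_mono) simp
    also have "\<dots> = 2 / w"
      using s w1 by (simp add: power2_eq_square)
    finally show ?thesis .
  qed
  then have "\<tau> k powr (1 + \<nu>) \<le> (2 / w) powr (1 + \<nu>)"
    using \<tau>_pos[of k] \<nu> by (intro powr_mono2) auto
  then have "A (Suc k) * \<tau> k powr (1 + \<nu>) \<le> (w * s)\<^sup>2 * (2 / w) powr (1 + \<nu>)"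
    unfolding A_eq S by (intro mult_left_mono) auto
  also have "\<dots> = R k * (2 powr (1 + \<nu>) * (w powr 2 / w powr (1 + \<nu>)))"
    using w1 s by (simp add: powr_divide power_mult_distrib power2_eq_square)
  also have "w powr 2 / w powr (1 + \<nu>) = w powr (1 - \<nu>)"
    by (simp add: powr_diff[symmetric] del: powr_numeral)
  also have "R k * (2 powr (1 + \<nu>) * w powr (1 - \<nu>)) \<le> R k * (2 powr 2 * (real k + 1) powr (1 - \<nu>))"
    using R_pos[of k] w1 wk \<nu> by (intro mult_left_mono mult_mono powr_mono powr_mono2) auto
  finally show ?thesis by simp
qed

section \<open>The objective and its lower model\<close>

lemma g_not_minf: "g z \<noteq> -\<infinity>"
  using proper by (simp add: proper_fun_def)

lemma g_eq: "z \<in> dom_g \<Longrightarrow> g z = ereal (h z)"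
  using g_not_minf[of z] by (cases "g z") auto

lemma psi_eq: "z \<in> dom_g \<Longrightarrow> psi f g z = ereal (f z + h z)"
  using g_eq[of z] by (metis plus_ereal.simps(1) psi_def)

lemma psi_ge: "psi f g xs \<le> psi f g z"
  using minimizer by (auto simp: is_arg_min_def not_less)

lemma xs_dom: "xs \<in> dom_g"
proof -
  obtain z where "g z \<noteq> \<infinity>"
    using proper by (auto simp: proper_fun_def)
  then show ?thesis
    using psi_ge[of z] psi_eq[of z] by (auto simp: psi_def)
qed

lemma psi_xs_le: "z \<in> dom_g \<Longrightarrow> f xs + h xs \<le> f z + h z"
  using psi_ge[of z] psi_eq[of z] psi_eq[OF xs_dom] by simp

lemma g_combination:
  assumes "z \<in> dom_g" "w \<in> dom_g" "0 < t" "t < 1"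
  shows "(1 - t) *\<^sub>R z + t *\<^sub>R w \<in> dom_g \<and>
    h ((1 - t) *\<^sub>R z + t *\<^sub>R w) \<le> (1 - t) * h z + t * h w"
proof -
  let ?u = "(1 - t) *\<^sub>R z + t *\<^sub>R w"
  have "g ?u \<le> ereal (1 - t) * g z + ereal t * g w"
    using assms by (intro convex[unfolded convex_ereal_fun_def, rule_format]) auto
  also have "\<dots> = ereal ((1 - t) * h z + t * h w)"
    using assms g_not_minf[of z] g_not_minf[of w] by (cases "g z"; cases "g w") auto
  finally show ?thesis
    using g_not_minf[of ?u] by (cases "g ?u") auto
qed

lemma convex_h: "convex_on dom_g h"
proof (rule convex_onI)
  show "convex dom_g"
    unfolding convex_alt
  proof (intro ballI allI impI)
    fix z w :: 'a and t :: real
    assume "z \<in> dom_g" "w \<in> dom_g" "0 \<le> t \<and> t \<le> 1"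
    then show "(1 - t) *\<^sub>R z + t *\<^sub>R w \<in> dom_g"
      using g_combination[of z w t] by (cases "t = 0 \<or> t = 1") auto
  qed
qed (use g_combination in blast)

lemma subgradient_ineq: "f z + G z \<bullet> (w - z) \<le> f w"
  using subgradient by (simp add: subgradient_selection_def)

text \<open>The subgradient inequality at \<open>w\<close> replaces the usual integration of the gradient along the segment; this
costs only the factor \<open>1 + \<nu>\<close>.\<close>

lemma holder_upper_bound:
  assumes "z \<in> cball xs (3 * D0)" "w \<in> cball xs (3 * D0)"
  shows "f w - f z - G z \<bullet> (w - z) \<le> M * norm (w - z) powr (1 + \<nu>)"
proof -
  have "f w - f z - G z \<bullet> (w - z) \<le> (G w - G z) \<bullet> (w - z)"
    using subgradient_ineq[of w z] by (simp add: inner_diff_left inner_diff_right)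
  also have "\<dots> \<le> norm ((G w - G z) \<bullet> (w - z))"
    by simp
  also have "\<dots> \<le> dual_norm (G w - G z) * norm (w - z)"
    unfolding dual_norm_def by (rule onorm[OF bounded_linear_inner_right])
  also have "\<dots> \<le> M * norm (w - z) powr \<nu> * norm (w - z)"
    using holder assms by (intro mult_right_mono) (auto simp: holder_smooth_on_def)
  also have "\<dots> = M * norm (w - z) powr (1 + \<nu>)"
    by (cases "w = z") (auto simp: powr_add)
  finally show ?thesis .
qed

text \<open>The lower model of \<open>A\<^sub>k \<psi>\<close> on the domain of \<open>g\<close>. The constants \<open>f (x i) - G (x i) \<bullet> x i\<close>, which
the subproblem of the algorithm leaves out, make it comparable with values of \<open>\<psi>\<close>.\<close>

definition Q :: "nat \<Rightarrow> 'a \<Rightarrow> real" where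
  "Q k z = (\<Sum>i=1..k. a i * (f (x i) + G (x i) \<bullet> (z - x i) + h z))"

lemma Q_0 [simp]: "Q 0 z = 0"
  by (simp add: Q_def)

lemma Q_Suc:
  "Q (Suc k) z = Q k z + a (Suc k) * (f (x (Suc k)) + G (x (Suc k)) \<bullet> (z - x (Suc k)) + h z)"
  by (simp add: Q_def)

text \<open>Splitting off the affine part shows that \<open>Q k\<close> differs by a constant from the function that the
algorithm minimizes, so both have the same minimizers after regularization.\<close>

lemma Q_affine:
  "Q k z = (\<Sum>i=1..k. a i * (f (x i) - G (x i) \<bullet> x i)) + (\<Sum>i=1..k. a i *\<^sub>R G (x i)) \<bullet> z + A k * h z"
proof -
  have "a i * (f (x i) + G (x i) \<bullet> (z - x i) + h z)
      = a i * (f (x i) - G (x i) \<bullet> x i) + (a i *\<^sub>R G (x i)) \<bullet> z + a i * h z" for i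
    by (simp add: inner_diff_right algebra_simps)
  then show ?thesis
    by (simp add: Q_def sum.distrib inner_sum_left sum_distrib_right sum_a[symmetric])
qed

lemma convex_Q: "convex_on dom_g (Q k)"
proof -
  have "convex dom_g"
    using convex_h by (rule convex_on_imp_convex)
  have "Q k (u *\<^sub>R z + t *\<^sub>R w) \<le> u * Q k z + t * Q k w"
    if "z \<in> dom_g" "w \<in> dom_g" "0 \<le> u" "0 \<le> t" "u + t = 1" for z w u t
  proof -
    let ?c = "\<Sum>i=1..k. a i * (f (x i) - G (x i) \<bullet> x i)"
    have "A k * h (u *\<^sub>R z + t *\<^sub>R w) \<le> A k * (u * h z + t * h w)"
      using convex_h that by (intro mult_left_mono A_nonneg) (auto simp: convex_on_def)
    moreover have "?c = u * ?c + t * ?c"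
      using that by (simp add: distrib_right[symmetric])
    ultimately show ?thesis
      unfolding Q_affine by (simp add: inner_add_right algebra_simps)
  qed
  then show ?thesis
    using \<open>convex dom_g\<close> by (auto simp: convex_on_def)
qed

lemma Q_xs_le: "Q k xs \<le> A k * (f xs + h xs)"
proof -
  have "Q k xs \<le> (\<Sum>i=1..k. a i * (f xs + h xs))"
    unfolding Q_def
  proof (rule sum_mono)
    fix i assume "i \<in> {1..k}"
    then have "0 \<le> a i"
      using a_pos[of "i - 1"] by (simp add: less_imp_le)
    then show "a i * (f (x i) + G (x i) \<bullet> (xs - x i) + h xs) \<le> a i * (f xs + h xs)"
      using subgradient_ineq[of "x i" xs] by (intro mult_left_mono) auto
  qed
  also have "\<dots> = A k * (f xs + h xs)"
    by (simp only: sum_distrib_right[symmetric] sum_a)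
  finally show ?thesis .
qed

lemma objective_eq:
  "(\<Sum>i=1..k+1. ereal (a i) * (ereal (G (x i) \<bullet> z) + g z)) =
    ereal ((\<Sum>i=1..k+1. a i *\<^sub>R G (x i)) \<bullet> z) + ereal (A (Suc k)) * g z"
proof (cases "g z")
  case (real t)
  then show ?thesis
    by (simp add: inner_sum_left sum_a[symmetric] sum_distrib_right sum.distrib inner_add_left
        sum_distrib_left A_Suc algebra_simps)
next
  case PInf
  have "ereal (a (k + 1)) * (ereal (G (x (k + 1)) \<bullet> z) + g z) = \<infinity>"
    using PInf a_pos[of k] by simp
  then have "(\<Sum>i=1..k+1. ereal (a i) * (ereal (G (x i) \<bullet> z) + g z)) = \<infinity>"
    by (subst sum_Pinfty) (auto intro!: bexI[of _ "k + 1"])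
  then show ?thesis
    using PInf A_Suc_pos[of k] by simp
qed (use g_not_minf in auto)

lemma V_minimizes:
  assumes b: "0 < b"
  shows "V k b \<in> dom_g"
    and "z \<in> dom_g \<Longrightarrow> Q (Suc k) (V k b) + b / 2 * (norm (V k b - x0))\<^sup>2
      \<le> Q (Suc k) z + b / 2 * (norm (z - x0))\<^sup>2"
proof -
  let ?P = "\<Sum>i=1..k+1. a i *\<^sub>R G (x i)"
  define \<Phi> where
    "\<Phi> z = ereal (?P \<bullet> z) + ereal (A (Suc k)) * g z + ereal (b / 2 * (norm (z - x0))\<^sup>2)" for z
  have V: "V k b = arg_min \<Phi> (\<lambda>_. True)"
    unfolding agda_v_def objective_eq \<Phi>_def ..
  obtain w where "\<And>z. \<Phi> w \<le> \<Phi> z"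
    using regularized_min_exists[OF proper lsc convex A_Suc_pos b, of ?P k x0]
    unfolding \<Phi>_def by blast
  then have "is_arg_min \<Phi> (\<lambda>_. True) w"
    by (auto simp: is_arg_min_def not_less)
  then have "is_arg_min \<Phi> (\<lambda>_. True) (V k b)"
    unfolding V arg_min_def by (rule someI)
  then have min: "\<Phi> (V k b) \<le> \<Phi> z" for z
    by (auto simp: is_arg_min_def not_less)
  have \<Phi>_dom: "\<Phi> z = ereal (?P \<bullet> z + A (Suc k) * h z + b / 2 * (norm (z - x0))\<^sup>2)"
    if "z \<in> dom_g" for z
    using that g_not_minf[of z] by (cases "g z") (auto simp: \<Phi>_def)
  have "\<Phi> (V k b) \<noteq> \<infinity>"
    using min[of xs] \<Phi>_dom[OF xs_dom] by auto
  then show dom: "V k b \<in> dom_g"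
    using A_Suc_pos[of k] by (auto simp: \<Phi>_def)
  show "Q (Suc k) (V k b) + b / 2 * (norm (V k b - x0))\<^sup>2
      \<le> Q (Suc k) z + b / 2 * (norm (z - x0))\<^sup>2" if "z \<in> dom_g"
    using min[of z] \<Phi>_dom[OF that] \<Phi>_dom[OF dom] by (simp add: Q_affine)
qed

section \<open>Acceptance in the line search\<close>

lemma run_0: "v 0 = x0" "y 0 = x0" "\<beta> 0 = \<beta>0"
  using run by (auto simp: agda_run_def)

lemma run_Suc:
  assumes "k < K"
  shows "x (Suc k) = \<tau> k *\<^sub>R v k + (1 - \<tau> k) *\<^sub>R y k"
    "\<beta> (Suc k) = line_search (l k) (\<beta>0 / (2 * (real k + 1)\<^sup>2)) (\<beta> k)"
    "v (Suc k) = V k (\<beta> (Suc k))" "y (Suc k) = Y k (\<beta> (Suc k))"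
  using run assms by (auto simp: agda_run_def)

lemma Y_minus_x: "k < K \<Longrightarrow> Y k b - x (Suc k) = \<tau> k *\<^sub>R (V k b - v k)"
  by (simp add: run_Suc agda_y_def algebra_simps)

lemma l_eq:
  assumes "k < K"
  shows "l k b = - f (Y k b) + f (x (Suc k)) + G (x (Suc k)) \<bullet> (Y k b - x (Suc k))
    + b / (64 * A (Suc k)) * (norm (V k b - v k))\<^sup>2
    + (b * (R k)\<^sup>2 - \<beta> k * (R_prev k)\<^sup>2) / (16 * A (Suc k))"
  using \<tau>_pos[of k]
  by (simp add: agda_l_def Let_def Y_minus_x[OF assms] power_mult_distrib)

lemma dist_V_antimono:
  assumes "0 < b" "b \<le> b'"
  shows "norm (V k b' - x0) \<le> norm (V k b - x0)"
  using proximal_path_stable(1)[OF convex_Q, of "V k b" "V k b'" b b' "Suc k" x0]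
    V_minimizes assms by auto

text \<open>A larger \<open>\<beta>\<close> keeps the trial points in a fixed ball around a fixed centre, on which the part of \<open>l\<close>
that involves \<open>f\<close> is bounded, while the last term of \<open>l\<close> grows linearly in \<open>\<beta>\<close>.\<close>

lemma line_search_terminates:
  assumes k: "k < K" and \<beta>k: "0 < \<beta> k"
  shows "\<exists>n. 0 \<le> l k (2 ^ n * \<beta> k)"
proof -
  let ?\<rho> = "norm (V k (\<beta> k) - x0)" and ?c = "\<tau> k *\<^sub>R x0 + (1 - \<tau> k) *\<^sub>R y k"
  let ?\<phi> = "\<lambda>w. - f w + f (x (Suc k)) + G (x (Suc k)) \<bullet> (w - x (Suc k))"
  have "continuous_on (cball ?c ?\<rho>) ?\<phi>"
    by (intro continuous_intros continuous_on_subset[OF f_cont]) auto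
  then have "\<exists>w0\<in>cball ?c ?\<rho>. \<forall>w\<in>cball ?c ?\<rho>. ?\<phi> w0 \<le> ?\<phi> w"
    by (intro continuous_attains_inf) auto
  then obtain w0 where w0: "\<And>w. w \<in> cball ?c ?\<rho> \<Longrightarrow> ?\<phi> w0 \<le> ?\<phi> w"
    by blast
  \<comment> \<open>At the multiple \<open>?B\<close> of \<open>\<beta> k\<close> the last term of \<open>l\<close> outweighs the lower bound \<open>?\<phi> w0\<close>.\<close>
  let ?B = "(\<beta> k * (R_prev k)\<^sup>2 + 16 * A (Suc k) * \<bar>?\<phi> w0\<bar>) / (\<beta> k * (R k)\<^sup>2)"
  obtain n where n: "?B < 2 ^ n"
    using real_arch_pow[of 2 ?B] by auto
  let ?b = "2 ^ n * \<beta> k"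
  have b: "0 < ?b" "\<beta> k \<le> ?b"
    using \<beta>k by auto
  have "dist ?c (Y k ?b) = \<tau> k * norm (V k ?b - x0)"
  proof -
    have "?c - Y k ?b = \<tau> k *\<^sub>R (x0 - V k ?b)"
      by (simp add: agda_y_def algebra_simps)
    then show ?thesis
      using \<tau>_pos[of k] by (simp add: dist_norm norm_minus_commute)
  qed
  also have "\<dots> \<le> 1 * ?\<rho>"
    using \<tau>_pos[of k] \<tau>_le[of k] dist_V_antimono[OF \<beta>k b(2)] by (intro mult_mono) auto
  finally have "?\<phi> w0 \<le> ?\<phi> (Y k ?b)"
    by (intro w0) simp
  moreover have "- ?\<phi> w0 \<le> (?b * (R k)\<^sup>2 - \<beta> k * (R_prev k)\<^sup>2) / (16 * A (Suc k))"
  proof -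
    have "0 < \<beta> k * (R k)\<^sup>2"
      using \<beta>k R_pos[of k] by simp
    then have "\<beta> k * (R_prev k)\<^sup>2 + 16 * A (Suc k) * \<bar>?\<phi> w0\<bar> \<le> 2 ^ n * (\<beta> k * (R k)\<^sup>2)"
      using n by (simp only: pos_divide_less_eq less_imp_le)
    then have "\<bar>?\<phi> w0\<bar> * (16 * A (Suc k)) \<le> ?b * (R k)\<^sup>2 - \<beta> k * (R_prev k)\<^sup>2"
      by (simp add: mult_ac)
    then have "\<bar>?\<phi> w0\<bar> \<le> (?b * (R k)\<^sup>2 - \<beta> k * (R_prev k)\<^sup>2) / (16 * A (Suc k))"
      using A_Suc_pos[of k] by (subst pos_le_divide_eq) auto
    then show ?thesis by linarith
  qed
  moreover have "0 \<le> ?b / (64 * A (Suc k)) * (norm (V k ?b - v k))\<^sup>2"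
    using b A_Suc_pos[of k] by simp
  ultimately have "0 \<le> l k ?b"
    unfolding l_eq[OF k] by linarith
  then show ?thesis by blast
qed

lemma \<beta>_line_search:
  assumes k: "k < K" and \<beta>k: "0 < \<beta> k"
  shows "0 \<le> l k (\<beta> (Suc k))" "\<beta> k \<le> \<beta> (Suc k)"
    "\<beta> (Suc k) = \<beta> k \<or> (\<exists>t. \<beta> k \<le> t \<and> t \<le> \<beta> (Suc k) \<and> l k t < 0 \<and>
      \<beta> (Suc k) \<le> t + \<beta>0 / (2 * (real k + 1)\<^sup>2))"
  using line_search_spec[OF _ \<beta>k line_search_terminates[OF assms],
      of "\<beta>0 / (2 * (real k + 1)\<^sup>2)"] \<beta>0
  unfolding run_Suc(2)[OF k, symmetric] by auto

lemma \<beta>_ge: "k \<le> K \<Longrightarrow> \<beta>0 \<le> \<beta> k"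
proof (induction k)
  case (Suc k)
  then show ?case
    using \<beta>_line_search(2)[of k] \<beta>0 by simp
qed (simp add: run_0)

lemma \<beta>_pos: "k \<le> K \<Longrightarrow> 0 < \<beta> k"
  using \<beta>_ge[of k] \<beta>0 by simp

lemma \<beta>_mono: "i \<le> j \<Longrightarrow> j \<le> K \<Longrightarrow> \<beta> i \<le> \<beta> j"
proof (induction j rule: dec_induct)
  case (step n)
  then show ?case
    using \<beta>_line_search(2)[of n] \<beta>_pos[of n] by simp
qed simp

section \<open>The estimate sequence\<close>

lemma y_combination: "k < K \<Longrightarrow> y (Suc k) = \<tau> k *\<^sub>R v (Suc k) + (1 - \<tau> k) *\<^sub>R y k"
  by (simp add: run_Suc agda_y_def)

lemma v_dom: "k < K \<Longrightarrow> v (Suc k) \<in> dom_g"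
  using V_minimizes(1)[of "\<beta> (Suc k)" k] \<beta>_pos[of "Suc k"] run_Suc(3)[of k] by simp

lemma y_dom: "k < K \<Longrightarrow> y (Suc k) \<in> dom_g"
proof (induction k)
  case 0
  then show ?case
    using v_dom[of 0] y_combination[of 0] by simp
next
  case (Suc k)
  then show ?case
    unfolding y_combination[OF Suc.prems]
    using v_dom[of "Suc k"] \<tau>_pos[of "Suc k"] \<tau>_le[of "Suc k"]
    by (intro convexD[OF convex_on_imp_convex[OF convex_h]]) auto
qed

text \<open>For \<open>k = 0\<close> the point \<open>y\<^sup>0 = x\<^sup>0\<close> may lie outside the domain of \<open>g\<close>; there \<open>\<tau>\<^sub>0 = 1\<close>, so it enters
with weight zero.\<close>

lemma h_y_le:
  assumes "k < K"
  shows "A (Suc k) * h (y (Suc k)) \<le> a (Suc k) * h (v (Suc k)) + A k * h (y k)"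
proof -
  have "h (y (Suc k)) \<le> \<tau> k * h (v (Suc k)) + (1 - \<tau> k) * h (y k)"
  proof (cases k)
    case 0
    then show ?thesis using y_combination[of 0] assms by simp
  next
    case (Suc j)
    then show ?thesis
      using convex_h v_dom[of k] y_dom[of j] y_combination[of k] \<tau>_pos[of k] \<tau>_le[of k] assms
      by (auto simp: convex_on_def simp del: mem_Collect_eq)
  qed
  then have "A (Suc k) * h (y (Suc k)) \<le> A (Suc k) * (\<tau> k * h (v (Suc k)) + (1 - \<tau> k) * h (y k))"
    using A_Suc_pos[of k] by (intro mult_left_mono) auto
  also have "\<dots> = (\<tau> k * A (Suc k)) * h (v (Suc k)) + ((1 - \<tau> k) * A (Suc k)) * h (y k)"
    by (simp add: algebra_simps)
  finally show ?thesis
    unfolding \<tau>_A .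
qed

text \<open>The invariant of the method. Besides the comparison with \<open>z = x\<^sup>*\<close>, the next step needs it at \<open>z = v\<^sup>k\<^sup>+\<^sup>1\<close>,
hence the quantification over \<open>z\<close>.\<close>

definition estimate :: "nat \<Rightarrow> bool" where
  "estimate k \<longleftrightarrow> (\<forall>z\<in>dom_g. A k * (f (y k) + h (y k)) + \<beta> k / 2 * (norm (z - v k))\<^sup>2
     \<le> Q k z + \<beta> k / 2 * (norm (z - x0))\<^sup>2 + 3 / 32 * \<beta> k * (R_prev k)\<^sup>2)"

lemma estimate_0: "estimate 0"
  using \<beta>0 by (simp add: estimate_def run_0)

text \<open>The line-search inequality bounds \<open>f\<close> at the new point by its linearization at \<open>x\<^sup>k\<^sup>+\<^sup>1\<close>. The
linearization splits along the convex combination defining \<open>y\<^sup>k\<^sup>+\<^sup>1\<close> into a part at \<open>v\<^sup>k\<^sup>+\<^sup>1\<close>, which is the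
new summand of \<open>Q\<close>, and a part at \<open>y\<^sup>k\<close>, to which the previous estimate applies with
\<open>z = v\<^sup>k\<^sup>+\<^sup>1\<close>.\<close>

lemma estimate_half_step:
  assumes k: "k < K" and est: "estimate k"
  shows "A (Suc k) * (f (y (Suc k)) + h (y (Suc k)))
    \<le> Q (Suc k) (v (Suc k)) + \<beta> k / 2 * (norm (v (Suc k) - x0))\<^sup>2
      + (\<beta> (Suc k) / 64 - \<beta> k / 2) * (norm (v (Suc k) - v k))\<^sup>2
      + \<beta> (Suc k) / 16 * (R k)\<^sup>2 + \<beta> k / 32 * (R_prev k)\<^sup>2"
proof -
  let ?X = "x (Suc k)" and ?v = "v (Suc k)" and ?y = "y (Suc k)" and ?A = "A (Suc k)"
  let ?e = "(norm (?v - v k))\<^sup>2" and ?b = "\<beta> (Suc k)"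
  note A = A_Suc_pos[of k]
  have "0 \<le> ?A * l k ?b"
    using \<beta>_line_search(1)[OF k \<beta>_pos] k A by simp
  also have "?A * l k ?b = ?A * (- f ?y + f ?X + G ?X \<bullet> (?y - ?X)) + ?b / 64 * ?e
      + (?b * (R k)\<^sup>2 - \<beta> k * (R_prev k)\<^sup>2) / 16"
    unfolding l_eq[OF k] run_Suc(3,4)[OF k, symmetric] using A by (simp add: field_simps)
  finally have search: "?A * f ?y \<le> ?A * f ?X + ?A * (G ?X \<bullet> (?y - ?X)) + ?b / 64 * ?e
      + (?b * (R k)\<^sup>2 - \<beta> k * (R_prev k)\<^sup>2) / 16"
    by (simp add: algebra_simps)
  have "?A *\<^sub>R (?y - ?X) = (\<tau> k * ?A) *\<^sub>R ?v + ((1 - \<tau> k) * ?A) *\<^sub>R y k - ?A *\<^sub>R ?X"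
    by (simp add: y_combination[OF k] algebra_simps)
  also have "\<dots> = a (Suc k) *\<^sub>R (?v - ?X) + A k *\<^sub>R (y k - ?X)"
    unfolding \<tau>_A by (simp add: A_Suc algebra_simps)
  finally have "G ?X \<bullet> (?A *\<^sub>R (?y - ?X)) = G ?X \<bullet> (a (Suc k) *\<^sub>R (?v - ?X) + A k *\<^sub>R (y k - ?X))"
    by (rule arg_cong)
  then have lin: "?A * (G ?X \<bullet> (?y - ?X)) = a (Suc k) * (G ?X \<bullet> (?v - ?X)) + A k * (G ?X \<bullet> (y k - ?X))"
    by (simp add: inner_add_right)
  have old: "A k * f ?X + A k * (G ?X \<bullet> (y k - ?X)) \<le> A k * f (y k)"
    using mult_left_mono[OF subgradient_ineq[of ?X "y k"] A_nonneg[of k]]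
    by (simp add: distrib_left)
  have est_v: "A k * f (y k) + A k * h (y k) + \<beta> k / 2 * ?e
      \<le> Q k ?v + \<beta> k / 2 * (norm (?v - x0))\<^sup>2 + 3 / 32 * \<beta> k * (R_prev k)\<^sup>2"
    using est v_dom[OF k] unfolding estimate_def by (simp add: distrib_left)
  have AX: "?A * f ?X = A k * f ?X + a (Suc k) * f ?X"
    by (simp add: A_Suc distrib_right)
  show ?thesis
    using search lin old est_v h_y_le[OF k] AX
    unfolding Q_Suc by (simp add: algebra_simps diff_divide_distrib)
qed

lemma v_three_point:
  assumes k: "k < K" and z: "z \<in> dom_g"
  shows "Q (Suc k) (v (Suc k)) + \<beta> (Suc k) / 2 * (norm (v (Suc k) - x0))\<^sup>2
      + \<beta> (Suc k) / 2 * (norm (z - v (Suc k)))\<^sup>2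
    \<le> Q (Suc k) z + \<beta> (Suc k) / 2 * (norm (z - x0))\<^sup>2"
  unfolding run_Suc(3)[OF k]
  using k by (intro proximal_three_point[OF convex_Q _ z] V_minimizes \<beta>_pos) auto

lemma norm_diff_square_le:
  fixes u w :: 'a
  shows "(norm (u - w))\<^sup>2 \<le> 2 * (norm u)\<^sup>2 + 2 * (norm w)\<^sup>2"
proof -
  have "(norm (u - w))\<^sup>2 + (norm (u + w))\<^sup>2 = 2 * (norm u)\<^sup>2 + 2 * (norm w)\<^sup>2"
    by (simp add: power2_norm_eq_inner inner_add_left inner_add_right inner_diff_left
        inner_diff_right inner_commute)
  then show ?thesis
    by (smt (verit) zero_le_power2)
qed

text \<open>It has to be shown that the term \<open>\<parallel>v\<^sup>k\<^sup>+\<^sup>1 - v\<^sup>k\<parallel>\<^sup>2\<close> is harmless although its coefficient may be positive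
when \<open>\<beta>\<close> jumps. The excess is at most \<open>(\<beta>\<^sub>k\<^sub>+\<^sub>1 - \<beta>\<^sub>k)/64\<close>, and after splitting the distance at
\<open>x\<^sup>0\<close> one half is absorbed by the increased regularization and the other by \<open>R\<^sub>k\<^sup>2\<close>; this
is the origin of \<open>3/32 = 1/16 + 1/32\<close>.\<close>

lemma estimate_Suc:
  assumes k: "k < K" and est: "estimate k"
  shows "estimate (Suc k)"
  unfolding estimate_def
proof
  fix z assume z: "z \<in> dom_g"
  let ?v = "v (Suc k)" and ?b = "\<beta> (Suc k)"
  let ?e = "(norm (?v - v k))\<^sup>2" and ?\<rho> = "(norm (?v - x0))\<^sup>2"
  have \<beta>: "\<beta> k \<le> ?b" "0 < \<beta> k"
    using \<beta>_mono[of k "Suc k"] \<beta>_pos[of k] k by auto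
  have "?e \<le> 2 * ?\<rho> + 2 * (norm (v k - x0))\<^sup>2"
    using norm_diff_square_le[of "?v - x0" "v k - x0"] by simp
  moreover have "(norm (v k - x0))\<^sup>2 \<le> (R k)\<^sup>2"
    using dist_v_le by (intro power_mono) auto
  ultimately have "(?b - \<beta> k) * ?e \<le> (?b - \<beta> k) * (2 * ?\<rho> + 2 * (R k)\<^sup>2)"
    using \<beta> by (intro mult_left_mono) auto
  moreover have "\<beta> k * (R_prev k)\<^sup>2 \<le> \<beta> k * (R k)\<^sup>2"
    using \<beta> R_prev_le[of k] R_prev_pos[of k] by (intro mult_left_mono power_mono) auto
  moreover have "0 \<le> \<beta> k * ?e" "0 \<le> (?b - \<beta> k) * ?\<rho>"
    using \<beta> by auto
  ultimately have "(?b / 64 - \<beta> k / 2) * ?e + ?b / 16 * (R k)\<^sup>2 + \<beta> k / 32 * (R_prev k)\<^sup>2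
      \<le> (?b - \<beta> k) / 2 * ?\<rho> + 3 / 32 * ?b * (R k)\<^sup>2"
    by (simp add: algebra_simps diff_divide_distrib)
  then show "A (Suc k) * (f (y (Suc k)) + h (y (Suc k))) + ?b / 2 * (norm (z - ?v))\<^sup>2
      \<le> Q (Suc k) z + ?b / 2 * (norm (z - x0))\<^sup>2 + 3 / 32 * ?b * (R_prev (Suc k))\<^sup>2"
    using estimate_half_step[OF assms] v_three_point[OF k z]
    unfolding R_eq_prev[symmetric] by (simp add: algebra_simps diff_divide_distrib)
qed

lemma estimate: "k \<le> K \<Longrightarrow> estimate k"
  by (induction k) (auto intro: estimate_0 estimate_Suc)

section \<open>Boundedness of the iterates\<close>

lemma gap_estimate:
  assumes "k \<le> K"
  shows "A k * (f (y k) + h (y k) - (f xs + h xs)) + \<beta> k / 2 * (norm (xs - v k))\<^sup>2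
    \<le> \<beta> k / 2 * D0\<^sup>2 + 3 / 32 * \<beta> k * (R_prev k)\<^sup>2"
proof -
  have "A k * (f (y k) + h (y k)) + \<beta> k / 2 * (norm (xs - v k))\<^sup>2
      \<le> A k * (f xs + h xs) + \<beta> k / 2 * D0\<^sup>2 + 3 / 32 * \<beta> k * (R_prev k)\<^sup>2"
    using estimate[OF assms] xs_dom Q_xs_le[of k]
    unfolding estimate_def by (fastforce simp: norm_minus_commute[of xs])
  then show ?thesis
    by (simp add: algebra_simps)
qed

lemma gap_nonneg:
  assumes "k \<le> K"
  shows "0 \<le> A k * (f (y k) + h (y k) - (f xs + h xs))"
proof (cases k)
  case (Suc j)
  then show ?thesis
    using psi_xs_le[OF y_dom[of j]] assms by (intro mult_nonneg_nonneg A_nonneg) auto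
qed simp

text \<open>If \<open>R\<^sub>k\<^sub>-\<^sub>1 \<le> 4 D\<^sub>0\<close>, the estimate at \<open>x\<^sup>*\<close> gives
\<open>\<parallel>v\<^sup>k - x\<^sup>*\<parallel>\<^sup>2 \<le> D\<^sub>0\<^sup>2 + 3/16 (4 D\<^sub>0)\<^sup>2 = 4 D\<^sub>0\<^sup>2\<close>, hence a distance of at most \<open>3 D\<^sub>0\<close> from \<open>x\<^sup>0\<close>, and the
bound for \<open>R\<close> persists.\<close>

lemma v_bounded: "k \<le> K \<Longrightarrow> R_prev k \<le> 4 * D0 \<and> norm (v k - xs) \<le> 2 * D0"
proof (induction k)
  case 0
  then show ?case using r run_0 by simp
next
  case (Suc k)
  have "norm (x0 - v k) \<le> D0 + norm (v k - xs)"
    using norm_triangle_ineq4[of "x0 - xs" "v k - xs"] by simp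
  also have "\<dots> \<le> 4 * D0"
    using Suc.IH Suc.prems D0_pos by linarith
  finally have R: "R_prev (Suc k) \<le> 4 * D0"
    using Suc by simp
  have "(R_prev (Suc k))\<^sup>2 \<le> (4 * D0)\<^sup>2"
    using R R_prev_pos[of "Suc k"] by (intro power_mono) auto
  then have "\<beta> (Suc k) * (R_prev (Suc k))\<^sup>2 \<le> \<beta> (Suc k) * (4 * D0)\<^sup>2"
    using \<beta>_pos[OF Suc.prems] by (intro mult_left_mono) auto
  then have "\<beta> (Suc k) / 2 * (norm (xs - v (Suc k)))\<^sup>2 \<le> \<beta> (Suc k) / 2 * (2 * D0)\<^sup>2"
    using gap_estimate[OF Suc.prems] gap_nonneg[OF Suc.prems] by (simp add: power_mult_distrib)
  then have "(norm (xs - v (Suc k)))\<^sup>2 \<le> (2 * D0)\<^sup>2"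
    using \<beta>_pos[OF Suc.prems] by (simp add: mult_le_cancel_left_pos)
  then have "norm (xs - v (Suc k)) \<le> 2 * D0"
    by (rule power2_le_imp_le) simp
  then show ?case
    using R by (simp add: norm_minus_commute)
qed

lemma dist_v_x0_le: "k \<le> K \<Longrightarrow> norm (v k - x0) \<le> 3 * D0"
  using v_bounded[of k] norm_triangle_ineq4[of "v k - xs" "x0 - xs"] by simp

lemma R_le: "k \<le> K \<Longrightarrow> R k \<le> 4 * D0"
  using v_bounded[of k] dist_v_x0_le[of k] D0_pos norm_minus_commute[of x0 "v k"]
  unfolding agda_rbar_def agda_rbar_prev.simps by (intro max.boundedI) linarith+

lemma v_in_ball: "k \<le> K \<Longrightarrow> v k \<in> cball xs (2 * D0)"
  using v_bounded[of k] by (simp add: dist_norm norm_minus_commute)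

lemma combination_in_ball:
  "u \<in> cball xs \<rho> \<Longrightarrow> w \<in> cball xs \<rho> \<Longrightarrow> \<tau> k *\<^sub>R u + (1 - \<tau> k) *\<^sub>R w \<in> cball xs \<rho>"
  using \<tau>_pos[of k] \<tau>_le[of k] by (intro convexD[OF convex_cball]) auto

lemma y_in_ball: "k \<le> K \<Longrightarrow> y k \<in> cball xs (2 * D0)"
proof (induction k)
  case 0
  then show ?case using v_in_ball[of 0] run_0 by simp
next
  case (Suc k)
  then show ?case
    using combination_in_ball[OF v_in_ball[of "Suc k"]] y_combination[of k] by simp
qed

text \<open>Bounding \<open>D\<^sub>0\<^sup>2 - \<parallel>x\<^sup>* - v\<^sup>k\<parallel>\<^sup>2\<close> by a multiple of \<open>D\<^sub>0 R\<^sub>k\<close>, not of \<open>D\<^sub>0\<^sup>2\<close>, is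
what produces the ratio \<open>R\<^sub>k / A\<^sub>k\<close> that the choice of \<open>k\<^sup>*\<close> minimizes.\<close>

lemma gap_le:
  assumes "k \<le> K"
  shows "A k * (f (y k) + h (y k) - (f xs + h xs)) \<le> 2 * \<beta> k * D0 * R k"
proof -
  let ?n = "norm (xs - v k)"
  have \<beta>: "0 < \<beta> k" using \<beta>_pos[OF assms] .
  have "D0 - R k \<le> ?n"
    using norm_triangle_ineq[of "x0 - v k" "v k - xs"] dist_v_le[of k]
    by (simp add: norm_minus_commute)
  then have "D0\<^sup>2 - ?n\<^sup>2 \<le> 2 * D0 * R k"
  proof (cases "R k \<le> D0")
    case True
    then have "(D0 - R k)\<^sup>2 \<le> ?n\<^sup>2"
      using \<open>D0 - R k \<le> ?n\<close> by (intro power_mono) auto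
    then show ?thesis
      using zero_le_power2[of "R k"] unfolding power2_diff by linarith
  next
    case False
    then have "D0 * D0 \<le> D0 * R k"
      by (intro mult_left_mono) auto
    moreover have "0 \<le> ?n\<^sup>2" "0 \<le> D0 * R k"
      using R_pos[of k] by (auto simp: less_imp_le)
    ultimately show ?thesis
      unfolding power2_eq_square by linarith
  qed
  moreover have "(R_prev k)\<^sup>2 \<le> 4 * D0 * R k"
    unfolding power2_eq_square
    using v_bounded[OF assms] R_prev_le[of k] R_prev_pos[of k] by (intro mult_mono) auto
  moreover have "0 \<le> D0 * R k"
    using R_pos[of k] by (simp add: less_imp_le)
  ultimately have "D0\<^sup>2 / 2 - ?n\<^sup>2 / 2 + 3 / 32 * (R_prev k)\<^sup>2 \<le> 2 * D0 * R k"
    by linarith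
  then have "\<beta> k * (D0\<^sup>2 / 2 - ?n\<^sup>2 / 2 + 3 / 32 * (R_prev k)\<^sup>2) \<le> \<beta> k * (2 * D0 * R k)"
    using \<beta> by (intro mult_left_mono) auto
  then show ?thesis
    using gap_estimate[OF assms] by (simp add: algebra_simps)
qed

text \<open>As \<open>t \<ge> \<beta>\<^sub>0\<close>, the bisection tolerance is small relative to \<open>t\<close>, and the proximal path moves by at most the
relative change of the parameter.\<close>

section \<open>Rejected trial values\<close>

lemma trial_point_close:
  assumes k: "k < K" and t: "\<beta> k \<le> t" "t \<le> \<beta> (Suc k)"
    and tol: "\<beta> (Suc k) \<le> t + \<beta>0 / (2 * (real k + 1)\<^sup>2)"
  shows "norm (V k t - v (Suc k)) \<le> norm (v (Suc k) - x0) / (2 * (real k + 1)\<^sup>2)"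
proof -
  have t_pos: "0 < t" "\<beta>0 \<le> t"
    using \<beta>_pos[of k] \<beta>_ge[of k] k t by auto
  have "t * norm (V k t - v (Suc k)) \<le> (\<beta> (Suc k) - t) * norm (v (Suc k) - x0)"
    unfolding run_Suc(3)[OF k]
    using proximal_path_stable(2)[OF convex_Q, of "V k t" "V k (\<beta> (Suc k))" t "\<beta> (Suc k)" "Suc k" x0]
      V_minimizes t_pos t by auto
  also have "\<dots> \<le> (t / (2 * (real k + 1)\<^sup>2)) * norm (v (Suc k) - x0)"
  proof (intro mult_right_mono)
    have "\<beta>0 / (2 * (real k + 1)\<^sup>2) \<le> t / (2 * (real k + 1)\<^sup>2)"
      using t_pos by (intro divide_right_mono) auto
    then show "\<beta> (Suc k) - t \<le> t / (2 * (real k + 1)\<^sup>2)"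
      using tol by linarith
  qed simp
  also have "\<dots> = t * (norm (v (Suc k) - x0) / (2 * (real k + 1)\<^sup>2))"
    by simp
  finally show ?thesis
    using t_pos by (simp only: mult_le_cancel_left_pos)
qed

text \<open>In the first iteration the tolerance is as large as \<open>\<beta>\<^sub>0/2\<close>, and \<open>v_bounded\<close> is too weak to keep the
trial points in the ball of radius \<open>3 D\<^sub>0\<close>. The distance \<open>\<parallel>v\<^sup>1 - x\<^sup>0\<parallel>\<close> that occurs in the
half step is therefore retained: as \<open>v\<^sup>0 = x\<^sup>0\<close>, it has the total coefficient
\<open>\<beta>\<^sub>1/2 - \<beta>\<^sub>1/64 = 31/64 \<beta>\<^sub>1\<close>.\<close>

lemma first_v_bound:
  assumes "0 < K"
  shows "(norm (v 1 - xs))\<^sup>2 + 31 / 32 * (norm (v 1 - x0))\<^sup>2 \<le> 4 * D0\<^sup>2"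
proof -
  let ?b = "\<beta> 1" and ?\<rho> = "(norm (v 1 - x0))\<^sup>2"
  have b: "0 < ?b" "\<beta> 0 \<le> ?b"
    using \<beta>_pos[of 1] \<beta>_mono[of 0 1] assms by auto
  have "R 0 = r" "R_prev 0 = r"
    using r run_0 by (auto simp: agda_rbar_def)
  moreover have "r\<^sup>2 \<le> 16 * D0\<^sup>2"
    using power_mono[OF r(2), of 2] r by (simp add: power_mult_distrib)
  then have "?b * r\<^sup>2 \<le> ?b * (16 * D0\<^sup>2)"
    using b by (intro mult_left_mono) auto
  moreover have "\<beta> 0 * r\<^sup>2 \<le> ?b * r\<^sup>2"
    using b by (intro mult_right_mono) auto
  moreover have "Q 1 xs \<le> A 1 * (f xs + h xs)"
    by (rule Q_xs_le)
  moreover have "A 1 * (f xs + h xs) \<le> A 1 * (f (y 1) + h (y 1))"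
    using psi_xs_le[OF y_dom[of 0]] assms A_nonneg[of 1] by (intro mult_left_mono) auto
  ultimately have "?b / 2 * (norm (xs - v 1))\<^sup>2 + 31 / 64 * ?b * ?\<rho> \<le> ?b / 2 * D0\<^sup>2 + 3 / 2 * ?b * D0\<^sup>2"
    using estimate_half_step[OF assms estimate_0] v_three_point[OF assms xs_dom] run_0
    by (simp add: algebra_simps norm_minus_commute[of xs])
  then have "?b * ((norm (xs - v 1))\<^sup>2 + 31 / 32 * ?\<rho>) \<le> ?b * (4 * D0\<^sup>2)"
    by (simp add: algebra_simps)
  then show ?thesis
    using b by (simp add: mult_le_cancel_left_pos norm_minus_commute)
qed

text \<open>The accepted point \<open>v\<^sup>k\<^sup>+\<^sup>1\<close> has distance at most \<open>2 D\<^sub>0\<close> from \<open>x\<^sup>*\<close>, and the trial point is close to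
it: relative to \<open>\<parallel>v\<^sup>k\<^sup>+\<^sup>1 - x\<^sup>0\<parallel> \<le> 3 D\<^sub>0\<close> the deviation is at most \<open>1/8\<close> for \<open>k \<ge> 1\<close>. For
\<open>k = 0\<close> the bound \<open>first_v_bound\<close> takes over.\<close>

lemma trial_point_in_ball:
  assumes k: "k < K" and t: "\<beta> k \<le> t" "t \<le> \<beta> (Suc k)"
    and tol: "\<beta> (Suc k) \<le> t + \<beta>0 / (2 * (real k + 1)\<^sup>2)"
  shows "V k t \<in> cball xs (3 * D0)"
proof -
  let ?\<rho> = "norm (v (Suc k) - x0)" and ?u = "norm (v (Suc k) - xs)"
  have "?u + ?\<rho> / (2 * (real k + 1)\<^sup>2) \<le> 3 * D0"
  proof (cases "k = 0")
    case True
    \<comment> \<open>Here \<open>2 u\<^sup>2 + \<rho>\<^sup>2/2\<close> is at most twice the quantity bounded in \<open>first_v_bound\<close>, thus at most \<open>8 D0\<^sup>2\<close>.\<close>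
    have "(?u + ?\<rho> / 2)\<^sup>2 \<le> 2 * ?u\<^sup>2 + ?\<rho>\<^sup>2 / 2"
      using zero_le_power2[of "?u - ?\<rho> / 2"] by (simp add: power2_sum power2_diff power_divide)
    also have "\<dots> \<le> 9 * D0\<^sup>2"
    proof -
      have "?u\<^sup>2 + 31 / 32 * ?\<rho>\<^sup>2 \<le> 4 * D0\<^sup>2"
        using first_v_bound True k by simp
      moreover have "0 \<le> ?\<rho>\<^sup>2" "0 \<le> D0\<^sup>2"
        by auto
      ultimately show ?thesis by linarith
    qed
    also have "\<dots> = (3 * D0)\<^sup>2"
      by (simp add: power_mult_distrib)
    finally have "?u + ?\<rho> / 2 \<le> 3 * D0"
      by (rule power2_le_imp_le) simp
    then show ?thesis using True by simp
  next
    case False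
    then have "8 \<le> 2 * (real k + 1)\<^sup>2"
      using power_mono[of 2 "real k + 1" 2] by simp
    then have "?\<rho> / (2 * (real k + 1)\<^sup>2) \<le> 3 * D0 / 8"
      using dist_v_x0_le[of "Suc k"] k by (intro frac_le) auto
    then show ?thesis
      using v_bounded[of "Suc k"] k D0_pos by linarith
  qed
  moreover have "norm (V k t - xs) \<le> norm (V k t - v (Suc k)) + ?u"
    using norm_triangle_ineq[of "V k t - v (Suc k)" "v (Suc k) - xs"] by simp
  ultimately show ?thesis
    using trial_point_close[OF assms] by (simp add: dist_norm norm_minus_commute)
qed

text \<open>With \<open>d = \<parallel>v(t) - v\<^sup>k\<parallel>\<close>, rejection and Hoelder smoothness give
an upper bound for \<open>p + q\<close> proportional to \<open>d\<^bsup>1+\<nu>\<^esup>\<close>, where \<open>p = t d\<^sup>2\<close> and \<open>q = (t - \<beta>\<^sub>k) R\<^sub>k\<^sup>2\<close>. Since \<open>p + q\<close> dominates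
every weighted geometric mean of \<open>p\<close> and \<open>q\<close>, the weights can be chosen such that the unknown \<open>d\<close> cancels;
\<open>1 - \<theta> = (1 + \<nu>)/2\<close> is this choice.\<close>

lemma rejected_trial_bound:
  assumes k: "k < K" and t: "\<beta> k < t" "t \<le> \<beta> (Suc k)"
    and tol: "\<beta> (Suc k) \<le> t + \<beta>0 / (2 * (real k + 1)\<^sup>2)" and rejected: "l k t < 0"
    and \<theta>: "\<theta> = (1 - \<nu>) / 2"
  shows "t powr (1 - \<theta>) * (t - \<beta> k) powr \<theta> \<le> 1024 * (M * D0 powr \<nu>) * (real k + 1) powr (2 * \<theta>)"
proof -
  let ?X = "x (Suc k)" and ?A = "A (Suc k)"
  define d where "d = norm (V k t - v k)"
  define L where "L = 4 * M * R k * (real k + 1) powr (1 - \<nu>)"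
  have t_pos: "0 < t"
    using \<beta>_pos[of k] k t by simp
  have \<theta>': "2 * (1 - \<theta>) = 1 + \<nu>" "2 * \<theta> = 1 - \<nu>" "0 \<le> \<theta>" "\<theta> \<le> 1"
    using \<nu> by (auto simp: \<theta> field_simps)
  have big: "cball xs (2 * D0) \<subseteq> cball xs (3 * D0)"
    by (intro subset_cball) simp
  have "?X \<in> cball xs (3 * D0)"
    unfolding run_Suc(1)[OF k] using v_in_ball[of k] y_in_ball[of k] k big
    by (intro combination_in_ball) auto
  moreover have "Y k t \<in> cball xs (3 * D0)"
    unfolding agda_y_def using trial_point_in_ball[OF k _ t(2) tol] t y_in_ball[of k] k big
    by (intro combination_in_ball) auto
  ultimately have "f (Y k t) - f ?X - G ?X \<bullet> (Y k t - ?X) \<le> M * (\<tau> k * d) powr (1 + \<nu>)"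
    using holder_upper_bound[of ?X "Y k t"] \<tau>_pos[of k] unfolding Y_minus_x[OF k] d_def by simp
  then have "t / (64 * ?A) * d\<^sup>2 + (t * (R k)\<^sup>2 - \<beta> k * (R_prev k)\<^sup>2) / (16 * ?A)
      < M * (\<tau> k * d) powr (1 + \<nu>)"
    using rejected unfolding l_eq[OF k] d_def by linarith
  then have scaled: "64 * ?A * (t / (64 * ?A) * d\<^sup>2 + (t * (R k)\<^sup>2 - \<beta> k * (R_prev k)\<^sup>2) / (16 * ?A))
      < 64 * ?A * (M * (\<tau> k * d) powr (1 + \<nu>))"
    using A_Suc_pos[of k] by (intro mult_strict_left_mono) auto
  have lhs: "64 * ?A * (t / (64 * ?A) * d\<^sup>2 + (t * (R k)\<^sup>2 - \<beta> k * (R_prev k)\<^sup>2) / (16 * ?A))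
      = t * d\<^sup>2 + 4 * (t * (R k)\<^sup>2 - \<beta> k * (R_prev k)\<^sup>2)"
    using A_Suc_pos[of k] by (simp add: field_simps)
  have rhs: "64 * ?A * (M * (\<tau> k * d) powr (1 + \<nu>)) = 64 * M * (?A * \<tau> k powr (1 + \<nu>)) * d powr (1 + \<nu>)"
    using \<tau>_pos[of k] by (simp add: powr_mult d_def)
  \<comment> \<open>The constant \<open>1024\<close> arises as \<open>64 * 4 * 4\<close>: from \<open>l\<close>, from \<open>\<tau>_powr_A_le\<close>, and from \<open>R k \<le> 4 * D0\<close>.\<close>
  have "64 * M * (?A * \<tau> k powr (1 + \<nu>)) * d powr (1 + \<nu>) \<le> 64 * L * d powr (1 + \<nu>)"
    using mult_left_mono[OF \<tau>_powr_A_le, of "64 * M" k] M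
    by (intro mult_right_mono) (auto simp: L_def mult_ac)
  then have "t * d\<^sup>2 + 4 * (t * (R k)\<^sup>2 - \<beta> k * (R_prev k)\<^sup>2) < 64 * L * d powr (1 + \<nu>)"
    using scaled unfolding lhs rhs by linarith
  moreover have "\<beta> k * (R_prev k)\<^sup>2 \<le> \<beta> k * (R k)\<^sup>2"
    using \<beta>_pos[of k] k R_prev_le[of k] R_prev_pos[of k] by (intro mult_left_mono power_mono) auto
  moreover have "0 < (t - \<beta> k) * (R k)\<^sup>2"
    using t R_pos[of k] by simp
  ultimately have main: "t * d\<^sup>2 + (t - \<beta> k) * (R k)\<^sup>2 < 64 * L * d powr (1 + \<nu>)"
    unfolding left_diff_distrib right_diff_distrib by linarith
  have d: "0 < d"
  proof (rule ccontr)
    assume "\<not> 0 < d"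
    then have "d = 0" by (simp add: d_def)
    then show False
      using main \<open>0 < (t - \<beta> k) * (R k)\<^sup>2\<close> by simp
  qed
  let ?p = "t * d\<^sup>2" and ?q = "(t - \<beta> k) * (R k)\<^sup>2"
  have pq: "0 < ?p" "0 < ?q"
    using t t_pos d R_pos[of k] by auto
  have "?p powr (1 - \<theta>) * ?q powr \<theta> \<le> (?p + ?q) powr (1 - \<theta>) * (?p + ?q) powr \<theta>"
    using pq \<theta>' by (intro mult_mono powr_mono2) auto
  also have "\<dots> = ?p + ?q"
    using pq by (simp add: powr_add[symmetric])
  finally have "?p powr (1 - \<theta>) * ?q powr \<theta> < 64 * L * d powr (1 + \<nu>)"
    using main by linarith
  moreover have "?p powr (1 - \<theta>) = t powr (1 - \<theta>) * d powr (1 + \<nu>)"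
  proof -
    have "(d\<^sup>2) powr (1 - \<theta>) = d powr (2 * (1 - \<theta>))"
      using d powr_powr[of d 2 "1 - \<theta>"] by simp
    then show ?thesis
      using t_pos \<theta>' by (simp add: powr_mult)
  qed
  moreover have "?q powr \<theta> = (t - \<beta> k) powr \<theta> * R k powr (1 - \<nu>)"
  proof -
    have "((R k)\<^sup>2) powr \<theta> = R k powr (2 * \<theta>)"
      using R_pos[of k] powr_powr[of "R k" 2 \<theta>] by simp
    then show ?thesis
      using t \<theta>' by (simp add: powr_mult)
  qed
  ultimately have "d powr (1 + \<nu>) * (t powr (1 - \<theta>) * (t - \<beta> k) powr \<theta> * R k powr (1 - \<nu>))
      < d powr (1 + \<nu>) * (64 * L)"
    by (simp add: mult_ac)
  then have "t powr (1 - \<theta>) * (t - \<beta> k) powr \<theta> * R k powr (1 - \<nu>) < 64 * L"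
    using d by (subst (asm) mult_less_cancel_left_pos) auto
  also have "64 * L = 256 * M * (real k + 1) powr (2 * \<theta>) * R k powr \<nu> * R k powr (1 - \<nu>)"
    using R_pos[of k] \<theta>' by (simp add: L_def powr_add[symmetric])
  finally have "t powr (1 - \<theta>) * (t - \<beta> k) powr \<theta> < 256 * M * (real k + 1) powr (2 * \<theta>) * R k powr \<nu>"
    using R_pos[of k] by (subst (asm) mult_less_cancel_right_pos) auto
  also have "\<dots> \<le> 256 * M * (real k + 1) powr (2 * \<theta>) * (4 * D0 powr \<nu>)"
  proof (intro mult_left_mono)
    have "R k powr \<nu> \<le> (4 * D0) powr \<nu>"
      using R_le[of k] R_pos[of k] k \<nu> by (intro powr_mono2) auto
    also have "\<dots> = 4 powr \<nu> * D0 powr \<nu>"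
      by (simp add: powr_mult)
    also have "\<dots> \<le> 4 powr 1 * D0 powr \<nu>"
      using \<nu> by (intro mult_right_mono powr_mono) auto
    finally show "R k powr \<nu> \<le> 4 * D0 powr \<nu>" by simp
  qed (use M in simp)
  finally show ?thesis
    by (simp add: mult_ac)
qed

lemma \<beta>_le:
  assumes "1 \<le> K"
  shows "\<beta> K \<le> (3 * \<beta>0 + 6144 * (M * D0 powr \<nu>)) * real K powr (3 * (1 - \<nu>) / 2)"
proof -
  define \<theta> where "\<theta> = (1 - \<nu>) / 2"
  have "\<beta> K \<le> (3 * \<beta>0 + 6 * (1024 * (M * D0 powr \<nu>))) * real K powr (3 * \<theta>)"
  proof (rule stepsize_growth)
    fix k assume k: "k < K"
    show "\<beta> (Suc k) = \<beta> k \<or>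
      (\<exists>t\<ge>\<beta> k. \<beta> (Suc k) \<le> t + \<beta>0 / (2 * (real k + 1)\<^sup>2) \<and>
         (t = \<beta> k \<or> t powr (1 - \<theta>) * (t - \<beta> k) powr \<theta>
            \<le> 1024 * (M * D0 powr \<nu>) * (real k + 1) powr (2 * \<theta>)))"
      using \<beta>_line_search(3)[OF k]
    proof (rule disj_forward)
      assume "\<exists>t. \<beta> k \<le> t \<and> t \<le> \<beta> (Suc k) \<and> l k t < 0 \<and>
        \<beta> (Suc k) \<le> t + \<beta>0 / (2 * (real k + 1)\<^sup>2)"
      then obtain t where t: "\<beta> k \<le> t" "t \<le> \<beta> (Suc k)" "l k t < 0"
        "\<beta> (Suc k) \<le> t + \<beta>0 / (2 * (real k + 1)\<^sup>2)"
        by blast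
      have "t = \<beta> k \<or> t powr (1 - \<theta>) * (t - \<beta> k) powr \<theta>
            \<le> 1024 * (M * D0 powr \<nu>) * (real k + 1) powr (2 * \<theta>)"
        using rejected_trial_bound[OF k _ t(2,4,3) \<theta>_def] t(1) by force
      then show "\<exists>t\<ge>\<beta> k. \<beta> (Suc k) \<le> t + \<beta>0 / (2 * (real k + 1)\<^sup>2) \<and>
         (t = \<beta> k \<or> t powr (1 - \<theta>) * (t - \<beta> k) powr \<theta>
            \<le> 1024 * (M * D0 powr \<nu>) * (real k + 1) powr (2 * \<theta>))"
        using t by blast
    qed (use k \<beta>_pos[of k] in auto)
  qed (use assms \<nu> M D0_pos \<beta>0 \<beta>_ge run_0 in \<open>auto simp: \<theta>_def\<close>)
  then show ?thesis
    by (simp add: \<theta>_def)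
qed

section \<open>The convergence rate\<close>

lemma gap_le_ratio:
  assumes "1 \<le> k" "k \<le> K"
  shows "f (y k) + h (y k) - (f xs + h xs) \<le> 2 * \<beta> K * D0 * (sqrt (R k) / S k)\<^sup>2"
proof -
  have A: "0 < A k"
    using A_Suc_pos[of "k - 1"] assms by simp
  have "2 * \<beta> k * D0 * R k \<le> 2 * \<beta> K * D0 * R k"
    using \<beta>_mono[of k K] assms R_pos[of k] by (intro mult_right_mono mult_left_mono) auto
  then have "A k * (f (y k) + h (y k) - (f xs + h xs)) \<le> 2 * \<beta> K * D0 * R k"
    using gap_le[OF assms(2)] by linarith
  then have "f (y k) + h (y k) - (f xs + h xs) \<le> 2 * \<beta> K * D0 * R k / A k"
    using A by (simp add: pos_le_divide_eq mult.commute)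
  then show ?thesis
    using R_pos[of k] by (simp add: A_eq power_divide)
qed

text \<open>The ratio \<open>q\<close> of the last to the first root satisfies \<open>q\<^sup>2 \<le> 4 D\<^sub>0/r\<close>. The maximum with \<open>1\<close> in the
logarithmic factor matters when \<open>r > D\<^sub>0\<close>, where \<open>ln (e D\<^sub>0/r)\<close> may be small or negative.\<close>

lemma min_ratio_le:
  assumes K: "1 \<le> K"
    and k: "is_arg_min (\<lambda>k. sqrt (R k) / S k) (\<lambda>k. 1 \<le> k \<and> k \<le> K) k"
  shows "(sqrt (R k) / S k)\<^sup>2
    \<le> 16 * (4 * D0 / r) powr (1 / real K) * (max 1 (ln (exp 1 * D0 / r)))\<^sup>2 / (real K)\<^sup>2"
proof -
  define m where "m = sqrt (R k) / S k"
  define \<Lambda> where "\<Lambda> = max 1 (ln (exp 1 * D0 / r))"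
  define q where "q = sqrt (R K) / sqrt (R 0)"
  have S_pos: "0 < S i" if "1 \<le> i" for i
    using S_Suc_pos[of "i - 1"] that by simp
  have k_range: "1 \<le> k" "k \<le> K"
    using k by (auto simp: is_arg_min_def)
  have m: "0 < m"
    using S_pos[OF k_range(1)] R_pos[of k] by (simp add: m_def)
  have "m * S i \<le> sqrt (R i)" if "1 \<le> i" "i \<le> K" for i
  proof -
    have "m \<le> sqrt (R i) / S i"
      using k that unfolding is_arg_min_def m_def by (auto simp: not_less)
    then show ?thesis
      using S_pos[OF that(1)] by (simp add: pos_le_divide_eq)
  qed
  then have ratio: "m * real K \<le> 2 * (1 + ln q) * q powr (1 / real K)"
    unfolding q_def using R_pos[of 0] m K
    by (intro min_ratio_partial_sums[of "\<lambda>i. sqrt (R i)"]) (auto intro: R_mono)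
  have R0: "R 0 = r"
    using r run_0 by (simp add: agda_rbar_def)
  have q1: "1 \<le> q"
    using R_mono[of 0 K] R_pos[of 0] by (simp add: q_def)
  have qq: "q\<^sup>2 \<le> 4 * D0 / r"
    using R_le[of K] R_pos[of K] R0 r by (simp add: q_def power_divide divide_right_mono)
  have "2 * ln q = ln (q\<^sup>2)"
    using q1 by (simp add: ln_realpow)
  also have "\<dots> \<le> ln (4 * (D0 / r))"
    using q1 qq by (intro ln_mono) auto
  also have "\<dots> = 2 * ln 2 + ln (D0 / r)"
  proof -
    have "ln (4 * (D0 / r)) = ln 4 + ln (D0 / r)"
      using D0_pos r by (simp add: ln_mult ln_div)
    then show ?thesis
      using ln_realpow[of 2 2] by simp
  qed
  also have "\<dots> \<le> 2 + (\<Lambda> - 1)"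
  proof -
    have "ln (exp 1 * D0 / r) = 1 + ln (D0 / r)"
      using D0_pos r by (simp add: ln_mult ln_div)
    then show ?thesis
      using ln_le_minus_one[of "2::real"] by (simp add: \<Lambda>_def)
  qed
  finally have "1 + ln q \<le> 2 * \<Lambda>"
    by (simp add: \<Lambda>_def)
  then have "2 * (1 + ln q) * q powr (1 / real K) \<le> 4 * \<Lambda> * q powr (1 / real K)"
    by (intro mult_right_mono) auto
  then have "(m * real K)\<^sup>2 \<le> (4 * \<Lambda> * q powr (1 / real K))\<^sup>2"
    using ratio m by (intro power_mono) auto
  also have "\<dots> = 16 * \<Lambda>\<^sup>2 * (q\<^sup>2) powr (1 / real K)"
  proof -
    have "(q powr (1 / real K))\<^sup>2 = (q\<^sup>2) powr (1 / real K)"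
      using q1 by (simp add: power2_eq_square powr_mult)
    then show ?thesis by (simp add: power_mult_distrib)
  qed
  also have "\<dots> \<le> 16 * \<Lambda>\<^sup>2 * (4 * D0 / r) powr (1 / real K)"
    using qq q1 by (intro mult_left_mono powr_mono2) auto
  finally have "m\<^sup>2 * (real K)\<^sup>2 \<le> 16 * (4 * D0 / r) powr (1 / real K) * \<Lambda>\<^sup>2"
    by (simp add: power_mult_distrib mult_ac)
  then show ?thesis
    using K by (simp add: pos_le_divide_eq m_def \<Lambda>_def)
qed

theorem agda_rate:
  assumes K: "1 \<le> K" and c: "\<beta>0 \<le> c * M * D0 powr \<nu>" "0 \<le> c"
    and k: "is_arg_min (\<lambda>k. sqrt (R k) / S k) (\<lambda>k. 1 \<le> k \<and> k \<le> K) k"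
  shows "psi f g (y k) - psi f g xs
    \<le> ereal (32 * (6144 + 3 * c) * (M * D0 powr (1 + \<nu>) * (4 * D0 / r) powr (1 / real K)
        * (max 1 (ln (exp 1 * D0 / r)))\<^sup>2 / real K powr ((1 + 3 * \<nu>) / 2)))"
proof -
  let ?E = "(4 * D0 / r) powr (1 / real K) * (max 1 (ln (exp 1 * D0 / r)))\<^sup>2"
  have k_range: "1 \<le> k" "k \<le> K"
    using k by (auto simp: is_arg_min_def)
  have "3 * \<beta>0 + 6144 * (M * D0 powr \<nu>) \<le> (6144 + 3 * c) * (M * D0 powr \<nu>)"
    using c by (simp add: algebra_simps)
  then have \<beta>K: "\<beta> K \<le> (6144 + 3 * c) * (M * D0 powr \<nu>) * real K powr (3 * (1 - \<nu>) / 2)"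
    using \<beta>_le[OF K] by (meson mult_right_mono order_trans powr_ge_zero)
  have "f (y k) + h (y k) - (f xs + h xs) \<le> 2 * \<beta> K * D0 * (sqrt (R k) / S k)\<^sup>2"
    by (rule gap_le_ratio[OF k_range])
  also have "\<dots> \<le> 2 * ((6144 + 3 * c) * (M * D0 powr \<nu>) * real K powr (3 * (1 - \<nu>) / 2)) * D0
      * (16 * (4 * D0 / r) powr (1 / real K) * (max 1 (ln (exp 1 * D0 / r)))\<^sup>2 / (real K)\<^sup>2)"
    using \<beta>K min_ratio_le[OF K k] \<beta>_pos[of K] M c
    by (intro mult_mono mult_left_mono mult_right_mono) auto
  also have "\<dots> = 32 * (6144 + 3 * c) * (M * (D0 powr \<nu> * D0) * ?E
      * (real K powr (3 * (1 - \<nu>) / 2) / (real K)\<^sup>2))"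
    by simp
  also have "D0 powr \<nu> * D0 = D0 powr (1 + \<nu>)"
    using D0_pos by (simp add: powr_add)
  also have "real K powr (3 * (1 - \<nu>) / 2) / (real K)\<^sup>2 = 1 / real K powr ((1 + 3 * \<nu>) / 2)"
  proof -
    have "real K powr (3 * (1 - \<nu>) / 2) / real K powr 2 = real K powr (- ((1 + 3 * \<nu>) / 2))"
      unfolding powr_diff[symmetric] by (rule arg_cong[where f = "\<lambda>e. real K powr e"]) (simp add: field_simps)
    then show ?thesis
      using K by (simp add: powr_minus_divide)
  qed
  finally have bound: "f (y k) + h (y k) - (f xs + h xs)
      \<le> 32 * (6144 + 3 * c) * (M * D0 powr (1 + \<nu>) * ?E * (1 / real K powr ((1 + 3 * \<nu>) / 2)))" .
  have "y k \<in> dom_g"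
    using y_dom[of "k - 1"] k_range by simp
  then have "psi f g (y k) - psi f g xs = ereal (f (y k) + h (y k) - (f xs + h xs))"
    using psi_eq[of "y k"] psi_eq[OF xs_dom] by simp
  then show ?thesis
    using bound by (simp add: mult.assoc)
qed

end

theorem theorem2:
  fixes c :: real
  shows "\<exists>C>0. \<forall>(f :: 'a::euclidean_space \<Rightarrow> real) (g :: 'a \<Rightarrow> ereal) (G :: 'a \<Rightarrow> 'a)
            (xstar :: 'a) (x0 :: 'a) (D0 :: real) (\<nu> :: real) (M :: real) (r :: real) (\<beta>0 :: real)
            (K :: nat) (x :: nat \<Rightarrow> 'a) (v :: nat \<Rightarrow> 'a) (y :: nat \<Rightarrow> 'a) (\<beta> :: nat \<Rightarrow> real)
            (kstar :: nat).
     continuous_on UNIV f \<and> convex_on UNIV f \<and> subgradient_selection f G \<and>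
     proper_fun g \<and> lsc_fun g \<and> convex_ereal_fun g \<and>
     is_arg_min (psi f g) (\<lambda>_. True) xstar \<and>
     D0 = norm (x0 - xstar) \<and>
     0 \<le> \<nu> \<and> \<nu> \<le> 1 \<and> 0 < M \<and> holder_smooth_on (cball xstar (3 * D0)) \<nu> M G \<and>
     0 < r \<and> r \<le> 4 * D0 \<and>
     0 < \<beta>0 \<and> \<beta>0 \<le> c * M * D0 powr \<nu> \<and>
     1 \<le> K \<and> agda_run f g G x0 r \<beta>0 K x v y \<beta> \<and>
     is_arg_min (\<lambda>k. sqrt (agda_rbar r x0 v k) / (\<Sum>i<k. sqrt (agda_rbar r x0 v i)))
       (\<lambda>k. 1 \<le> k \<and> k \<le> K) kstar
     \<longrightarrow>
     psi f g (y kstar) - psi f g xstar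
       \<le> ereal (C * (M * D0 powr (1 + \<nu>) * (4 * D0 / r) powr (1 / real K)
                        * (max 1 (ln (exp 1 * D0 / r)))\<^sup>2
                      / real K powr ((1 + 3 * \<nu>) / 2)))"
proof (intro exI[of _ "32 * (6144 + 3 * \<bar>c\<bar>)"] conjI allI impI; (elim conjE)?)
  fix f :: "'a \<Rightarrow> real" and g G xstar x0 D0 \<nu> M r \<beta>0 K x v y \<beta> kstar
  assume "continuous_on UNIV f" "subgradient_selection f G" "proper_fun g" "lsc_fun g"
    "convex_ereal_fun g" "is_arg_min (psi f g) (\<lambda>_. True) xstar" and D0: "D0 = norm (x0 - xstar)"
    and "0 \<le> \<nu>" "\<nu> \<le> 1" "0 < M" "holder_smooth_on (cball xstar (3 * D0)) \<nu> M G"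
    "0 < r" "r \<le> 4 * D0" "0 < \<beta>0" and \<beta>0_le: "\<beta>0 \<le> c * M * D0 powr \<nu>" and K: "1 \<le> K"
    and "agda_run f g G x0 r \<beta>0 K x v y \<beta>"
    and kstar: "is_arg_min (\<lambda>k. sqrt (agda_rbar r x0 v k) / (\<Sum>i<k. sqrt (agda_rbar r x0 v i)))
       (\<lambda>k. 1 \<le> k \<and> k \<le> K) kstar"
  then interpret agda_iteration f g G xstar x0 \<nu> M r \<beta>0 K x v y \<beta>
    by unfold_locales auto
  have "c * (M * D0 powr \<nu>) \<le> \<bar>c\<bar> * (M * D0 powr \<nu>)"
    using M by (intro mult_right_mono) auto
  then have "\<beta>0 \<le> \<bar>c\<bar> * M * norm (x0 - xstar) powr \<nu>"
    using \<beta>0_le by (simp add: D0 mult.assoc)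
  then show "psi f g (y kstar) - psi f g xstar
       \<le> ereal (32 * (6144 + 3 * \<bar>c\<bar>) * (M * D0 powr (1 + \<nu>) * (4 * D0 / r) powr (1 / real K)
                        * (max 1 (ln (exp 1 * D0 / r)))\<^sup>2 / real K powr ((1 + 3 * \<nu>) / 2)))"
    unfolding D0 by (intro agda_rate[OF K _ _ kstar]) auto
qed simp

end
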